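(* There exists a constant $\alpha^{\ast\ast}>0$ such that, for every $\alpha\in(-\infty,32\pi^2)$ with $32\pi^{2}-\alpha>\alpha^{\ast\ast}$, the supremum $S(\alpha)$ is not attained; that is, there is no $u\in H$ with $\int_{\mathbb{R}^4}(\exp(32\pi^2|u|^2)-1-\alpha|u|^2)\,dx=S(\alpha)$.
   Context: $H:=\{u\in H^2(\mathbb{R}^4): \|u\|_{H^2(\mathbb{R}^4)}=1\}$, where $\|u\|_{H^2(\mathbb{R}^4)}=\left(\int_{\mathbb{R}^4}(|u|^2+|\Delta u|^2)\,dx\right)^{1/2}$. For $\alpha\in(-\infty,32\pi^2)$, $$S(\alpha)=\sup_{u\in H}\int_{\mathbb{R}^4}\left(\exp(32\pi^2|u|^2)-1-\alpha|u|^2\right)dx .$$ *)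

theory Defs
  imports "HOL-Analysis.Analysis"
begin

definition partial_deriv :: "'a::euclidean_space \<Rightarrow> ('a \<Rightarrow> real) \<Rightarrow> 'a \<Rightarrow> real" where
  "partial_deriv b f = (\<lambda>x. frechet_derivative f (at x) b)"

fun iter_partial_deriv :: "'a::euclidean_space list \<Rightarrow> ('a \<Rightarrow> real) \<Rightarrow> 'a \<Rightarrow> real" where
  "iter_partial_deriv [] f = f"
| "iter_partial_deriv (b # bs) f = partial_deriv b (iter_partial_deriv bs f)"

primrec C_k :: "nat \<Rightarrow> ('a::euclidean_space \<Rightarrow> real) \<Rightarrow> bool" where
  "C_k 0 f \<longleftrightarrow> continuous_on UNIV f"
| "C_k (Suc k) f \<longleftrightarrow>
     (\<forall>x. f differentiable (at x)) \<and> (\<forall>b\<in>Basis. C_k k (partial_deriv b f))"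

definition test_function :: "('a::euclidean_space \<Rightarrow> real) \<Rightarrow> bool" where
  "test_function \<phi> \<longleftrightarrow> (\<forall>k. C_k k \<phi>) \<and> compact (closure {x. \<phi> x \<noteq> 0})"

(* Functions, not classes modulo null sets: every class has a Borel representative, and
   all notions below are invariant under changes on null sets. *)
definition L2 :: "('a::euclidean_space \<Rightarrow> real) set" where
  "L2 = {u \<in> borel_measurable lborel. integrable lborel (\<lambda>x. (u x)\<^sup>2)}"

(* A list of basis vectors of length m encodes an m-th order derivative. *)
definition has_weak_partial_deriv ::
    "('a::euclidean_space \<Rightarrow> real) \<Rightarrow> 'a list \<Rightarrow> ('a \<Rightarrow> real) \<Rightarrow> bool" where
  "has_weak_partial_deriv u bs v \<longleftrightarrow>
     (\<forall>\<phi>. test_function \<phi> \<longrightarrow>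
        (\<integral>x. u x * iter_partial_deriv bs \<phi> x \<partial>lborel) =
        (-1) ^ length bs * (\<integral>x. v x * \<phi> x \<partial>lborel))"

(* H^k = W^{k,2} on the whole space. *)
definition sobolev_H :: "nat \<Rightarrow> ('a::euclidean_space \<Rightarrow> real) set" where
  "sobolev_H k =
     {u \<in> L2. \<forall>bs. set bs \<subseteq> Basis \<and> length bs \<le> k \<longrightarrow>
                  (\<exists>v\<in>L2. has_weak_partial_deriv u bs v)}"

(* Determined up to a null set when an L^2 weak derivative exists, arbitrary otherwise. *)
definition weak_partial_deriv ::
    "'a::euclidean_space list \<Rightarrow> ('a \<Rightarrow> real) \<Rightarrow> 'a \<Rightarrow> real" where
  "weak_partial_deriv bs u = (SOME v. v \<in> L2 \<and> has_weak_partial_deriv u bs v)"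

definition weak_laplacian :: "('a::euclidean_space \<Rightarrow> real) \<Rightarrow> 'a \<Rightarrow> real" where
  "weak_laplacian u = (\<lambda>x. \<Sum>b\<in>Basis. weak_partial_deriv [b, b] u x)"

definition H2_norm :: "('a::euclidean_space \<Rightarrow> real) \<Rightarrow> real" where
  "H2_norm u = sqrt (\<integral>x. \<bar>u x\<bar>\<^sup>2 + \<bar>weak_laplacian u x\<bar>\<^sup>2 \<partial>lborel)"

definition H :: "(real^4 \<Rightarrow> real) set" where
  "H = {u \<in> sobolev_H 2. H2_norm u = 1}"

definition adams_integrand :: "real \<Rightarrow> real \<Rightarrow> real" where
  "adams_integrand \<alpha> t = exp (32 * pi\<^sup>2 * \<bar>t\<bar>\<^sup>2) - 1 - \<alpha> * \<bar>t\<bar>\<^sup>2"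

(* Hence the nonnegative integral below involves no truncation. *)
lemma adams_integrand_nonneg:
  assumes "\<alpha> \<le> 32 * pi\<^sup>2"
  shows "0 \<le> adams_integrand \<alpha> t"
proof -
  have "1 + 32 * pi\<^sup>2 * \<bar>t\<bar>\<^sup>2 \<le> exp (32 * pi\<^sup>2 * \<bar>t\<bar>\<^sup>2)"
    by (rule exp_ge_add_one_self)
  moreover have "\<alpha> * \<bar>t\<bar>\<^sup>2 \<le> 32 * pi\<^sup>2 * \<bar>t\<bar>\<^sup>2"
    using assms by (intro mult_right_mono) auto
  ultimately show ?thesis
    unfolding adams_integrand_def by linarith
qed

definition adams_functional :: "real \<Rightarrow> (real^4 \<Rightarrow> real) \<Rightarrow> ennreal" where
  "adams_functional \<alpha> u = (\<integral>\<^sup>+ x. ennreal (adams_integrand \<alpha> (u x)) \<partial>lborel)"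

definition S :: "real \<Rightarrow> ennreal" where
  "S \<alpha> = (SUP u\<in>H. adams_functional \<alpha> u)"

end

theory Submission
  imports Defs
begin

text \<open>
  Put \<open>\<beta> = 32 \<pi>\<^sup>2 - \<alpha>\<close>, \<open>n = \<parallel>u\<parallel>\<^sub>2\<^sup>2\<close> and \<open>d = \<parallel>\<Delta>u\<parallel>\<^sub>2\<^sup>2\<close>, so that \<open>n + d = 1\<close> on
  the unit sphere, and write the functional as \<open>\<beta> n + P(u)\<close>, where \<open>P(u)\<close> is the integral of
  \<open>exp t - 1 - t\<close> at \<open>t = 32 \<pi>\<^sup>2 u\<^sup>2\<close>. Everything rests on the two-parameter family
  \<open>v(x) = l u(\<mu> x)\<close>: in dimension four \<open>\<parallel>\<Delta>v\<parallel>\<^sub>2\<^sup>2 = l\<^sup>2 d\<close> does not depend on \<open>\<mu>\<close>, so for every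
  \<open>l\<close> with \<open>l\<^sup>2 d < 1\<close> a suitable \<open>\<mu>\<close> brings \<open>v\<close> back to the unit sphere (\<open>H_scale\<close>).

  Letting \<open>l\<close> tend to \<open>0\<close> spreads the mass out and shows that the supremum is at least \<open>\<beta>\<close>
  (\<open>S_ge_vanishing_level\<close>). So it suffices to prove that every \<open>u\<close> stays strictly below \<open>\<beta>\<close>,
  which is the inequality \<open>P(u) < \<beta> d\<close>.

  The sharp Adams inequality, i.e. finiteness of \<open>M = sup P\<close> over the unit sphere, can be bypassed
  by a case distinction. If \<open>M\<close> is finite, then taking \<open>l \<ge> 1\<close> in the family above and using
  \<open>exp (s t) - 1 - s t \<le> s\<^sup>2 (exp t - 1 - t)\<close> for \<open>0 \<le> s \<le> 1\<close> gives \<open>P(u) \<le> 4 M d\<close>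
  (\<open>exp_energy_le_laplacian\<close>), and any \<open>\<beta> > 4 M\<close> will do; moreover \<open>d > 0\<close>, since for \<open>d = 0\<close> the
  parameter \<open>l\<close> is unrestricted and forces \<open>P(u) = 0\<close>. If \<open>M\<close> is infinite, then the supremum is
  infinite for every \<open>\<alpha>\<close>, and it is not attained because \<open>P(u)\<close> is finite for each single \<open>u\<close>.

  That last fact (\<open>exp_rem_integrable\<close>) is the analytic core. The kernel
  \<open>1 / (|x|\<^sup>2 + \<delta>)\<close>, cut off smoothly, is an admissible test function, and its Laplacian in dimension
  four is minus an approximate identity, up to normalisation and an error bounded by a multiple of
  \<open>1 / |x|\<^sup>2\<close>. Letting \<open>\<delta>\<close> tend to \<open>0\<close> gives \<open>|u| \<le> C (k * f)\<close> almost everywhere, where \<open>k\<close> is the Newton kernel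
  restricted to the unit ball and \<open>f = |u| + |\<Delta>u|\<close> (\<open>sobolev_pointwise_bound\<close>). A weighted
  Cauchy--Schwarz inequality bounds \<open>(k * f)\<^sup>2\<close> by \<open>\<parallel>f\<parallel>\<^sub>2\<^sup>2\<close> times a logarithm of \<open>k * f\<^sup>2\<close>, so
  \<open>exp (b (k * f)\<^sup>2)\<close> grows at most linearly in the integrable function \<open>k * f\<^sup>2\<close> once
  \<open>\<parallel>f\<parallel>\<^sub>2\<close> is small (\<open>exp_potential_le\<close>). Truncation reduces an arbitrary \<open>f\<close> to a bounded part
  plus such a small part.

  The mollification argument also yields the fundamental lemma of the calculus of variations, hence
  uniqueness of weak derivatives, which is what makes the arbitrarily chosen \<open>weak_laplacian\<close> behave
  well under rescaling.
\<close>

section \<open>Smooth radial functions with compact support\<close>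

lemma partial_deriv_eq:
  assumes "\<And>x. (f has_derivative D x) (at x)"
  shows "partial_deriv b f = (\<lambda>x. D x b)"
  unfolding partial_deriv_def using assms by (metis frechet_derivative_at)

text \<open>
  Unfolding \<open>C_k\<close> leaves a \<open>frechet_derivative\<close>, which is an unspecified choice; this rule lets closure
  properties be proved with an explicit derivative instead.
\<close>
lemma C_k_SucI:
  assumes "\<And>x. (f has_derivative D x) (at x)"
    and "\<And>b. b \<in> Basis \<Longrightarrow> C_k k (\<lambda>x. D x b)"
  shows "C_k (Suc k) f"
  using assms partial_deriv_eq[of f D] by (auto simp: differentiable_def)

lemma C_k_Suc_has_derivative:
  assumes "C_k (Suc k) f"
  obtains D where "\<And>x. (f has_derivative D x) (at x)" "\<And>b. b \<in> Basis \<Longrightarrow> C_k k (\<lambda>x. D x b)"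
proof -
  have "\<And>x. (f has_derivative frechet_derivative f (at x)) (at x)"
    using assms by (auto simp: frechet_derivative_works)
  then show ?thesis using that[of "\<lambda>x. frechet_derivative f (at x)"] assms
    by (auto simp: partial_deriv_def)
qed

lemma C_k_Suc_imp: "C_k (Suc k) f \<Longrightarrow> C_k k f"
proof (induction k arbitrary: f)
  case 0
  then show ?case
    by (auto intro!: continuous_at_imp_continuous_on differentiable_imp_continuous_within)
next
  case (Suc k)
  then show ?case by (metis C_k.simps(2))
qed

lemma C_k_imp_continuous: "C_k k f \<Longrightarrow> continuous_on UNIV f"
  by (induction k) (use C_k_Suc_imp in auto)

lemma C_k_const: "C_k k (\<lambda>x. c)"
proof (induction k arbitrary: c)
  case (Suc k)
  show ?case by (rule C_k_SucI[where D = "\<lambda>_ _. 0"]) (auto intro: Suc)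
qed auto

lemma C_k_add: "C_k k f \<Longrightarrow> C_k k g \<Longrightarrow> C_k k (\<lambda>x. f x + g x)"
proof (induction k arbitrary: f g)
  case (Suc k)
  obtain D where D: "\<And>x. (f has_derivative D x) (at x)" "\<And>b. b \<in> Basis \<Longrightarrow> C_k k (\<lambda>x. D x b)"
    using C_k_Suc_has_derivative[OF Suc.prems(1)] by blast
  obtain E where E: "\<And>x. (g has_derivative E x) (at x)" "\<And>b. b \<in> Basis \<Longrightarrow> C_k k (\<lambda>x. E x b)"
    using C_k_Suc_has_derivative[OF Suc.prems(2)] by blast
  show ?case
    by (rule C_k_SucI[where D = "\<lambda>x y. D x y + E x y"])
       (auto intro!: has_derivative_add D E Suc.IH)
qed (auto intro: continuous_on_add)

lemma C_k_mult: "C_k k f \<Longrightarrow> C_k k g \<Longrightarrow> C_k k (\<lambda>x. f x * g x)"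
proof (induction k arbitrary: f g)
  case (Suc k)
  obtain D where D: "\<And>x. (f has_derivative D x) (at x)" "\<And>b. b \<in> Basis \<Longrightarrow> C_k k (\<lambda>x. D x b)"
    using C_k_Suc_has_derivative[OF Suc.prems(1)] by blast
  obtain E where E: "\<And>x. (g has_derivative E x) (at x)" "\<And>b. b \<in> Basis \<Longrightarrow> C_k k (\<lambda>x. E x b)"
    using C_k_Suc_has_derivative[OF Suc.prems(2)] by blast
  show ?case
  proof (rule C_k_SucI)
    show "((\<lambda>x. f x * g x) has_derivative (\<lambda>y. f x * E x y + D x y * g x)) (at x)" for x
      by (rule has_derivative_mult[OF D(1) E(1)])
    show "C_k k (\<lambda>x. f x * E x b + D x b * g x)" if "b \<in> Basis" for b
      using D(2)[OF that] E(2)[OF that] Suc.prems[THEN C_k_Suc_imp]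
      by (intro C_k_add Suc.IH)
  qed
qed (auto intro: continuous_on_mult)

lemma C_k_inner: "C_k k (\<lambda>x. (x - a) \<bullet> b)"
proof (cases k)
  case (Suc j)
  show ?thesis unfolding Suc
    by (rule C_k_SucI[where D = "\<lambda>x y. y \<bullet> b"]) (auto intro!: derivative_eq_intros C_k_const)
qed (auto intro!: continuous_intros)

lemma has_derivative_norm_sq:
  "((\<lambda>y. (norm (y - a))\<^sup>2) has_derivative (\<lambda>z. 2 * ((y - a) \<bullet> z))) (at y)"
  for a y :: "'a::euclidean_space"
  unfolding power2_norm_eq_inner
  by (auto intro!: derivative_eq_intros simp: inner_commute)

lemma C_k_norm_sq: "C_k k (\<lambda>y. (norm (y - a))\<^sup>2)" for a :: "'a::euclidean_space"
proof (cases k)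
  case (Suc j)
  show ?thesis unfolding Suc
    by (rule C_k_SucI[OF has_derivative_norm_sq]) (intro C_k_mult C_k_const C_k_inner)
qed (auto intro!: continuous_intros)

lemma C_k_inverse:
  assumes "\<And>x. f x \<noteq> 0" "C_k k f"
  shows "C_k k (\<lambda>x. inverse (f x))"
  using assms(2)
proof (induction k)
  case (Suc k)
  obtain D where D: "\<And>x. (f has_derivative D x) (at x)" "\<And>b. b \<in> Basis \<Longrightarrow> C_k k (\<lambda>x. D x b)"
    using C_k_Suc_has_derivative[OF Suc.prems] by blast
  have IH: "C_k k (\<lambda>x. inverse (f x))" using Suc C_k_Suc_imp by blast
  show ?case
  proof (rule C_k_SucI)
    show "((\<lambda>x. inverse (f x)) has_derivative (\<lambda>y. (-1) * (inverse (f x) * D x y * inverse (f x)))) (at x)" for x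
      using Deriv.has_derivative_inverse[OF assms(1) D(1), of x] by simp
    show "C_k k (\<lambda>x. (-1) * (inverse (f x) * D x b * inverse (f x)))" if "b \<in> Basis" for b
      using D(2)[OF that] IH by (intro C_k_mult C_k_const)
  qed
qed (use assms in \<open>auto intro: continuous_on_inverse\<close>)

lemma C_k_power: "C_k k f \<Longrightarrow> C_k k (\<lambda>x. f x ^ n)"
  by (induction n) (auto intro: C_k_const C_k_mult)

text \<open>
  The functions \<open>p(1/t) exp(-1/t)\<close>, extended by zero, are closed under differentiation, so that a
  single induction, for all polynomials \<open>p\<close> at once, proves smoothness of the classical bump function \<open>p = 1\<close>.
\<close>
definition flat :: "real poly \<Rightarrow> real \<Rightarrow> real" where
  "flat p t = (if t > 0 then poly p (1 / t) * exp (- (1 / t)) else 0)"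

text \<open>
  With \<open>w = 1/t\<close> one has \<open>dw/dt = - w\<^sup>2\<close>, so \<open>p(w) exp(-w)\<close> has derivative
  \<open>w\<^sup>2 (p(w) - p'(w)) exp(-w)\<close>.
\<close>
definition flat_deriv :: "real poly \<Rightarrow> real poly" where
  "flat_deriv p = [:0, 0, 1:] * (p - pderiv p)"

lemma poly_times_exp_neg_at_top:
  "((\<lambda>w. poly p w * exp (- w)) \<longlongrightarrow> 0) at_top" for p :: "real poly"
proof -
  have "((\<lambda>w. \<Sum>i\<le>degree p. coeff p i * (w ^ i / exp w)) \<longlongrightarrow> (\<Sum>i\<le>degree p. coeff p i * 0)) at_top"
    by (intro tendsto_intros tendsto_power_div_exp_0)
  then show ?thesis
    by (simp add: poly_altdef sum_distrib_right exp_minus divide_inverse mult.assoc)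
qed

lemma flat_has_derivative: "(flat p has_real_derivative flat (flat_deriv p) t) (at t)"
proof -
  consider "t < 0" | "t > 0" | "t = 0" by linarith
  then show ?thesis
  proof cases
    case 1
    have "((\<lambda>t::real. 0::real) has_real_derivative 0) (at t)" by simp
    then have "(flat p has_real_derivative 0) (at t)"
      by (rule has_field_derivative_transform_within_open[where S = "{..<0}"])
         (use 1 in \<open>auto simp: flat_def\<close>)
    then show ?thesis using 1 by (simp add: flat_def)
  next
    case 2
    have "((\<lambda>t. poly p (1 / t) * exp (- (1 / t))) has_real_derivative flat (flat_deriv p) t) (at t)"
      using 2 by (auto intro!: derivative_eq_intros DERIV_chain'[where g = "poly p", OF _ poly_DERIV]
            simp: flat_def flat_deriv_def field_simps power2_eq_square)
    then show ?thesis
      by (rule has_field_derivative_transform_within_open[where S = "{0<..}"])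
         (use 2 in \<open>auto simp: flat_def\<close>)
  next
    case 3
    have "((\<lambda>h. poly ([:0,1:] * p) (1 / h) * exp (- (1 / h))) \<longlongrightarrow> 0) (at_right 0)"
      using poly_times_exp_neg_at_top[of "[:0,1:] * p"]
      by (rule filterlim_compose) (simp add: filterlim_inverse_at_top_right divide_inverse)
    then have r: "((\<lambda>h. (flat p (0 + h) - flat p 0) / h) \<longlongrightarrow> 0) (at_right 0)"
      by (rule Lim_transform_eventually)
         (auto simp: flat_def eventually_at_filter field_simps)
    have l: "((\<lambda>h. (flat p (0 + h) - flat p 0) / h) \<longlongrightarrow> 0) (at_left 0)"
      by (rule Lim_transform_eventually[OF tendsto_const])
         (auto simp: flat_def eventually_at_filter)
    have "((\<lambda>h. (flat p (0 + h) - flat p 0) / h) \<longlongrightarrow> 0) (at 0)"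
      using filterlim_split_at[OF l r] .
    then show ?thesis using 3 by (simp add: DERIV_def flat_def)
  qed
qed

lemma C_k_flat: "C_k k (\<lambda>y. flat p (1 - (norm (y - a))\<^sup>2))" for a :: "'a::euclidean_space"
proof (induction k arbitrary: p)
  case 0
  have "continuous_on UNIV (flat p)"
    by (meson DERIV_continuous_on flat_has_derivative has_field_derivative_at_within)
  then show ?case
    by (auto intro!: continuous_on_compose2[of UNIV "flat p"] continuous_intros)
next
  case (Suc k)
  show ?case
  proof (rule C_k_SucI)
    show "((\<lambda>y. flat p (1 - (norm (y - a))\<^sup>2)) has_derivative
        (\<lambda>z. flat (flat_deriv p) (1 - (norm (y - a))\<^sup>2) * ((-2) * ((y - a) \<bullet> z)))) (at y)" for y
      using has_derivative_compose[OF has_derivative_diff[OF has_derivative_const[of 1] has_derivative_norm_sq]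
          flat_has_derivative[unfolded has_field_derivative_def]]
      by (simp add: algebra_simps)
    show "C_k k (\<lambda>y. flat (flat_deriv p) (1 - (norm (y - a))\<^sup>2) * ((-2) * ((y - a) \<bullet> b)))" for b
      by (intro C_k_mult Suc.IH C_k_const C_k_inner)
  qed
qed

text \<open>
  As a function of \<open>s = |x - a|\<^sup>2\<close>: a bump supported in the unit ball around \<open>a\<close>, divided by a
  regularised power of the distance. Both the regularised Newton kernel (\<open>p = 1\<close>, \<open>m = 1\<close>) and all
  terms of its derivatives have this form.
\<close>
definition cutoff :: "real poly \<Rightarrow> nat \<Rightarrow> real \<Rightarrow> real \<Rightarrow> real" where
  "cutoff p m \<delta> s = flat p (1 - s) / (s + \<delta>) ^ m"

lemma test_function_cutoff:
  fixes a :: "'a::euclidean_space"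
  assumes "\<delta> > 0"
  shows "test_function (\<lambda>y. cutoff p m \<delta> ((norm (y - a))\<^sup>2))"
proof -
  have nz: "(norm (y - a))\<^sup>2 + \<delta> \<noteq> 0" for y using assms by (smt (verit) zero_le_power2)
  have "C_k k (\<lambda>y. flat p (1 - (norm (y - a))\<^sup>2) * inverse ((norm (y - a))\<^sup>2 + \<delta>) ^ m)" for k
    by (intro C_k_mult C_k_flat C_k_power C_k_inverse C_k_add C_k_const C_k_norm_sq nz)
  moreover have "{y. cutoff p m \<delta> ((norm (y - a))\<^sup>2) \<noteq> 0} \<subseteq> cball a 1"
  proof
    fix y assume "y \<in> {y. cutoff p m \<delta> ((norm (y - a))\<^sup>2) \<noteq> 0}"
    then have "(norm (y - a))\<^sup>2 < 1" by (auto simp: cutoff_def flat_def split: if_splits)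
    then have "norm (y - a) < 1" by (simp add: power_less_one_iff)
    then show "y \<in> cball a 1" by (simp add: dist_norm norm_minus_commute)
  qed
  then have "bounded {y. cutoff p m \<delta> ((norm (y - a))\<^sup>2) \<noteq> 0}"
    using bounded_cball bounded_subset by blast
  ultimately show ?thesis
    by (auto simp: test_function_def cutoff_def divide_inverse power_inverse compact_closure)
qed

lemma iter_partial_deriv2_radial:
  fixes a :: "'a::euclidean_space"
  assumes F: "\<And>s. s \<ge> 0 \<Longrightarrow> (F has_real_derivative F1 s) (at s)"
    and F1: "\<And>s. s \<ge> 0 \<Longrightarrow> (F1 has_real_derivative F2 s) (at s)"
  shows "iter_partial_deriv [b, b] (\<lambda>y. F ((norm (y - a))\<^sup>2)) y =
     4 * F2 ((norm (y - a))\<^sup>2) * ((y - a) \<bullet> b)\<^sup>2 + 2 * F1 ((norm (y - a))\<^sup>2) * (b \<bullet> b)"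
proof -
  have 1: "((\<lambda>y. G ((norm (y - a))\<^sup>2)) has_derivative
      (\<lambda>z. G' ((norm (y - a))\<^sup>2) * (2 * ((y - a) \<bullet> z)))) (at y)"
    if "\<And>s. s \<ge> 0 \<Longrightarrow> (G has_real_derivative G' s) (at s)" for G G' y
    using has_derivative_compose[OF has_derivative_norm_sq
        that[unfolded has_field_derivative_def, of "(norm (y - a))\<^sup>2"]] by simp
  have "partial_deriv b (\<lambda>y. F ((norm (y - a))\<^sup>2)) =
      (\<lambda>y. F1 ((norm (y - a))\<^sup>2) * (2 * ((y - a) \<bullet> b)))"
    by (rule partial_deriv_eq[OF 1[OF F]])
  moreover have "((\<lambda>y. F1 ((norm (y - a))\<^sup>2) * (2 * ((y - a) \<bullet> b))) has_derivative
      (\<lambda>z. F1 ((norm (y - a))\<^sup>2) * (2 * (z \<bullet> b)) + F2 ((norm (y - a))\<^sup>2) * (2 * ((y - a) \<bullet> z)) * (2 * ((y - a) \<bullet> b)))) (at y)" for y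
    by (rule has_derivative_mult[OF 1[OF F1]]) (auto intro!: derivative_eq_intros)
  note partial_deriv_eq[OF this, of b]
  ultimately show ?thesis
    by (simp add: power2_eq_square algebra_simps)
qed

section \<open>The truncated Newton kernel and an exponential estimate for its potentials\<close>

definition newton_kernel :: "real^4 \<Rightarrow> real" where
  "newton_kernel z = (if norm z < 1 then 1 / (norm z)\<^sup>2 else 0)"

lemma newton_kernel_nonneg: "newton_kernel z \<ge> 0" by (simp add: newton_kernel_def)

lemma newton_kernel_measurable [measurable]: "newton_kernel \<in> borel_measurable borel"
  unfolding newton_kernel_def by measurable

lemma ball_measurable [measurable]: "ball a r \<in> sets (borel :: 'a::metric_space measure)"
  by auto

lemma cball_measurable [measurable]: "cball a r \<in> sets (borel :: 'a::metric_space measure)"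
  by auto

text \<open>
  The change of variables for the positive integral in any dimension.
\<close>
lemma nn_integral_lborel_affine:
  fixes f :: "'a::euclidean_space \<Rightarrow> ennreal"
  assumes [measurable]: "f \<in> borel_measurable borel" and c: "c \<noteq> 0"
  shows "(\<integral>\<^sup>+x. f x \<partial>lborel) = ennreal (\<bar>c\<bar> ^ DIM('a)) * (\<integral>\<^sup>+x. f (t + c *\<^sub>R x) \<partial>lborel)"
  by (subst lborel_affine[OF c, of t])
     (simp add: nn_integral_density nn_integral_distr nn_integral_cmult ennreal_power)

text \<open>
  Layer-cake substitute for polar coordinates: \<open>G(|z|) = G(1) + (integral of g over [|z|, 1])\<close>,
  and after exchanging the integrals each level \<open>t\<close> contributes the volume of a ball of radius \<open>t\<close>.
\<close>
lemma nn_integral_radial_le: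
  fixes G g :: "real \<Rightarrow> real"
  assumes [measurable]: "g \<in> borel_measurable borel"
    and deriv: "\<And>t. 0 < t \<Longrightarrow> t \<le> 1 \<Longrightarrow> (G has_real_derivative - g t) (at t)"
    and g: "\<And>t. 0 < t \<Longrightarrow> t \<le> 1 \<Longrightarrow> 0 \<le> g t" and G1: "G 1 \<ge> 0"
  shows "(\<integral>\<^sup>+z. ennreal (G (norm z)) * indicator (ball 0 1) z \<partial>(lborel :: (real^4) measure))
    \<le> ennreal (unit_ball_vol 4) * (ennreal (G 1) + (\<integral>\<^sup>+t. ennreal (g t * t ^ 4) * indicator {0..1} t \<partial>lborel))"
proof -
  define w where "w t = ennreal (g t) * indicator {0..1} t" for t
  have [measurable]: "w \<in> borel_measurable borel" unfolding w_def by measurable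
  have AE: "AE z in lborel. z \<noteq> (0::real^4)" by (rule AE_lborel_singleton)
  have "(\<integral>\<^sup>+z. ennreal (G (norm z)) * indicator (ball 0 1) z \<partial>(lborel :: (real^4) measure))
    \<le> (\<integral>\<^sup>+z. ennreal (G 1) * indicator (ball 0 1) z + (\<integral>\<^sup>+t. w t * (if norm (z::real^4) \<le> t then 1 else 0) \<partial>lborel) \<partial>lborel)"
  proof (rule nn_integral_mono_AE, use AE in eventually_elim)
    fix z :: "real^4" assume z: "z \<noteq> 0"
    show "ennreal (G (norm z)) * indicator (ball 0 1) z
      \<le> ennreal (G 1) * indicator (ball 0 1) z + (\<integral>\<^sup>+t. w t * (if norm z \<le> t then 1 else 0) \<partial>lborel)"
    proof (cases "norm z < 1")
      case True
      have eq: "(\<integral>\<^sup>+t. ennreal (g t) * indicator {norm z..1} t \<partial>lborel) = ennreal (- G 1 - - G (norm z))"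
      proof (rule nn_integral_FTC_Icc[where F = "\<lambda>t. - G t"])
        fix t assume "t \<in> {norm z..1}"
        then have t: "0 < t" "t \<le> 1" using z by (auto simp: less_le_trans[of 0 "norm z"])
        show "((\<lambda>t. - G t) has_real_derivative g t) (at t)" using DERIV_minus[OF deriv[OF t]] by simp
        show "0 \<le> g t" by (rule g[OF t])
      qed (use True in auto)
      have "G 1 \<le> G (norm z)"
      proof (rule DERIV_nonpos_imp_nonincreasing[of "norm z" 1 G])
        fix t assume "norm z \<le> t" "t \<le> 1"
        then show "\<exists>y. DERIV G t :> y \<and> y \<le> 0"
          using deriv[of t] g[of t] z by (intro exI[of _ "- g t"]) (auto simp: less_le_trans[of 0 "norm z"])
      qed (use True in simp)
      then have "ennreal (G (norm z)) = ennreal (G 1) + ennreal (- G 1 - - G (norm z))"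
        using G1 by (subst ennreal_plus[symmetric]) auto
      also have "\<dots> = ennreal (G 1) + (\<integral>\<^sup>+t. w t * (if norm z \<le> t then 1 else 0) \<partial>lborel)"
        unfolding eq[symmetric] w_def
        by (intro arg_cong2[where f = "(+)"] refl nn_integral_cong) (auto simp: indicator_def intro: order_trans[OF norm_ge_zero])
      finally show ?thesis using True by simp
    qed simp
  qed
  also have "\<dots> = ennreal (G 1) * emeasure lborel (ball 0 1 :: (real^4) set)
      + (\<integral>\<^sup>+z. \<integral>\<^sup>+t. w t * (if norm (z::real^4) \<le> t then 1 else 0) \<partial>lborel \<partial>lborel)"
    by (subst nn_integral_add) (auto simp: nn_integral_cmult)
  also have "(\<integral>\<^sup>+z. \<integral>\<^sup>+t. w t * (if norm (z::real^4) \<le> t then 1 else 0) \<partial>lborel \<partial>lborel)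
      = (\<integral>\<^sup>+t. \<integral>\<^sup>+z. w t * (if norm (z::real^4) \<le> t then 1 else 0) \<partial>lborel \<partial>lborel)"
    by (rule lborel_pair.Fubini'[symmetric]) measurable
  also have "\<dots> = (\<integral>\<^sup>+t. w t * ennreal (unit_ball_vol 4 * t ^ 4) \<partial>lborel)"
  proof (rule nn_integral_cong)
    fix t :: real
    have "(\<integral>\<^sup>+z. w t * (if norm (z::real^4) \<le> t then 1 else 0) \<partial>lborel) = w t * emeasure lborel (cball (0::real^4) t)"
      by (subst nn_integral_cmult_indicator[symmetric]) (auto intro!: nn_integral_cong simp: indicator_def)
    then show "(\<integral>\<^sup>+z. w t * (if norm (z::real^4) \<le> t then 1 else 0) \<partial>lborel) = w t * ennreal (unit_ball_vol 4 * t ^ 4)"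
      by (cases "t \<ge> 0") (simp_all add: emeasure_cball w_def)
  qed
  also have "\<dots> = (\<integral>\<^sup>+t. ennreal (unit_ball_vol 4) * (ennreal (g t * t ^ 4) * indicator {0..1} t) \<partial>lborel)"
  proof (rule nn_integral_cong)
    fix t :: real
    show "w t * ennreal (unit_ball_vol 4 * t ^ 4) = ennreal (unit_ball_vol 4) * (ennreal (g t * t ^ 4) * indicator {0..1} t)"
      using g[of t] by (cases "t = 0") (auto simp: w_def indicator_def ennreal_mult' mult_ac)
  qed
  also have "\<dots> = ennreal (unit_ball_vol 4) * (\<integral>\<^sup>+t. ennreal (g t * t ^ 4) * indicator {0..1} t \<partial>lborel)"
    by (rule nn_integral_cmult) measurable
  also have "emeasure lborel (ball 0 1 :: (real^4) set) = ennreal (unit_ball_vol 4)"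
    by (simp add: emeasure_ball)
  finally show ?thesis by (simp add: algebra_simps)
qed

lemma nn_integral_newton_kernel: "(\<integral>\<^sup>+z. ennreal (newton_kernel z) \<partial>lborel) \<le> ennreal (2 * unit_ball_vol 4)"
proof -
  have "(\<integral>\<^sup>+z. ennreal (newton_kernel z) \<partial>lborel) = (\<integral>\<^sup>+z. ennreal (1 / (norm z)\<^sup>2) * indicator (ball 0 1) (z::real^4) \<partial>lborel)"
    by (intro nn_integral_cong) (auto simp: newton_kernel_def indicator_def)
  also have "\<dots> \<le> ennreal (unit_ball_vol 4) * (ennreal (1 / 1\<^sup>2) + (\<integral>\<^sup>+t. ennreal (2 / t ^ 3 * t ^ 4) * indicator {0..1} t \<partial>lborel))"
    by (rule nn_integral_radial_le[where G = "\<lambda>t. 1 / t\<^sup>2"])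
       (auto intro!: derivative_eq_intros simp: field_simps eval_nat_numeral)
  also have "(\<integral>\<^sup>+t. ennreal (2 / t ^ 3 * t ^ 4) * indicator {0..1} t \<partial>lborel) = (\<integral>\<^sup>+t. ennreal (2 * t) * indicator {0..1} t \<partial>lborel)"
    by (intro nn_integral_cong) (auto simp: eval_nat_numeral)
  also have "\<dots> = ennreal (1\<^sup>2 - 0\<^sup>2)"
    by (rule nn_integral_FTC_Icc) (auto intro!: derivative_eq_intros)
  also have "ennreal (unit_ball_vol 4) * (ennreal (1 / 1\<^sup>2) + ennreal (1\<^sup>2 - 0\<^sup>2)) = ennreal (2 * unit_ball_vol 4)"
    by (simp add: ennreal_mult'' flip: ennreal_plus ennreal_1) (simp add: mult.commute)
  finally show ?thesis .
qed

text \<open>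
  In polar coordinates the integrand behaves like \<open>t / (t\<^sup>2 + \<tau>)\<close>. The logarithm that this produces is
  the borderline behaviour of dimension four and the origin of exponential integrability.
\<close>
lemma nn_integral_newton_kernel_regularised:
  assumes \<tau>: "\<tau> > 0"
  shows "(\<integral>\<^sup>+z. ennreal (1 / ((norm z)\<^sup>2 * ((norm z)\<^sup>2 + \<tau>))) * indicator (ball 0 1) (z::real^4) \<partial>lborel)
     \<le> ennreal (unit_ball_vol 4 * (1 + 2 * ln (1 + 1 / \<tau>)))"
proof -
  let ?g = "\<lambda>t::real. 2 / (t ^ 3 * (t\<^sup>2 + \<tau>)) + 2 / (t * (t\<^sup>2 + \<tau>)\<^sup>2)"
  have nz: "t\<^sup>2 + \<tau> > 0" for t :: real using \<tau> by (simp add: add_nonneg_pos)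
  have "(\<integral>\<^sup>+z. ennreal (1 / ((norm z)\<^sup>2 * ((norm z)\<^sup>2 + \<tau>))) * indicator (ball 0 1) (z::real^4) \<partial>lborel)
     \<le> ennreal (unit_ball_vol 4) * (ennreal (1 / (1\<^sup>2 * (1\<^sup>2 + \<tau>))) + (\<integral>\<^sup>+t. ennreal (?g t * t ^ 4) * indicator {0..1} t \<partial>lborel))"
  proof (rule nn_integral_radial_le[where G = "\<lambda>t. 1 / (t\<^sup>2 * (t\<^sup>2 + \<tau>))"])
    fix t :: real assume t: "0 < t" "t \<le> 1"
    have "((\<lambda>t. inverse (t\<^sup>2 * (t\<^sup>2 + \<tau>))) has_real_derivative
        - (inverse (t\<^sup>2 * (t\<^sup>2 + \<tau>)) * (2 * t * (t\<^sup>2 + \<tau>) + t\<^sup>2 * (2 * t)) * inverse (t\<^sup>2 * (t\<^sup>2 + \<tau>)))) (at t)"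
      using t nz[of t] by (intro DERIV_inverse') (auto intro!: derivative_eq_intros)
    moreover have "inverse (t\<^sup>2 * (t\<^sup>2 + \<tau>)) * (2 * t * (t\<^sup>2 + \<tau>) + t\<^sup>2 * (2 * t)) * inverse (t\<^sup>2 * (t\<^sup>2 + \<tau>)) = ?g t"
    proof -
      define X where "X = t\<^sup>2 + \<tau>"
      have "X \<noteq> 0" using nz[of t] by (simp add: X_def)
      then show ?thesis using t unfolding X_def[symmetric] by (simp add: field_simps eval_nat_numeral)
    qed
    ultimately show "((\<lambda>t. 1 / (t\<^sup>2 * (t\<^sup>2 + \<tau>))) has_real_derivative - ?g t) (at t)"
      by (simp add: inverse_eq_divide)
    show "0 \<le> ?g t" using t nz[of t] by simp
  qed (use \<tau> in \<open>auto\<close>)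
  also have "\<dots> \<le> ennreal (unit_ball_vol 4) * (ennreal 1 + (\<integral>\<^sup>+t. ennreal (2 * (2 * t / (t\<^sup>2 + \<tau>))) * indicator {0..1} t \<partial>lborel))"
  proof (intro mult_left_mono add_mono nn_integral_mono)
    fix t :: real
    show "ennreal (?g t * t ^ 4) * indicator {0..1} t \<le> ennreal (2 * (2 * t / (t\<^sup>2 + \<tau>))) * indicator {0..1} t"
    proof (cases "t \<in> {0<..1}")
      case True
      define X where "X = t\<^sup>2 + \<tau>"
      have X: "X > 0" "t\<^sup>2 \<le> X" using nz[of t] \<tau> by (simp_all add: X_def)
      have "?g t * t ^ 4 = 2 * t / X + 2 * t / X * (t\<^sup>2 / X)"
        using True X unfolding X_def[symmetric] by (simp add: field_simps eval_nat_numeral)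
      also have "\<dots> \<le> 2 * t / X + 2 * t / X * 1"
        using True X by (intro add_left_mono mult_left_mono) auto
      finally show ?thesis unfolding X_def using True by (auto intro: ennreal_leI)
    qed (auto simp: indicator_def)
  qed (use \<tau> in auto)
  also have "(\<integral>\<^sup>+t. ennreal (2 * (2 * t / (t\<^sup>2 + \<tau>))) * indicator {0..1} t \<partial>lborel)
      = ennreal (2 * ln (1\<^sup>2 + \<tau>) - 2 * ln (0\<^sup>2 + \<tau>))"
    using nz \<tau> by (intro nn_integral_FTC_Icc) (auto intro!: derivative_eq_intros simp: nz less_imp_le)
  also have "2 * ln (1\<^sup>2 + \<tau>) - 2 * ln (0\<^sup>2 + \<tau>) = 2 * ln (1 + 1 / \<tau>)"
  proof -
    have "1 + 1 / \<tau> = (1 + \<tau>) / \<tau>" using \<tau> by (simp add: field_simps)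
    then show ?thesis using \<tau> by (simp add: ln_div)
  qed
  also have "ennreal (unit_ball_vol 4) * (ennreal 1 + ennreal (2 * ln (1 + 1 / \<tau>)))
     = ennreal (unit_ball_vol 4 * (1 + 2 * ln (1 + 1 / \<tau>)))"
    using \<tau> by (subst ennreal_plus[symmetric]) (auto simp: ennreal_mult)
  finally show ?thesis .
qed

definition potential :: "(real^4 \<Rightarrow> real) \<Rightarrow> real^4 \<Rightarrow> ennreal" where
  "potential f x = (\<integral>\<^sup>+y. ennreal (newton_kernel (y - x) * f y) \<partial>lborel)"

lemma potential_measurable [measurable]:
  assumes [measurable]: "f \<in> borel_measurable borel"
  shows "potential f \<in> borel_measurable borel"
  unfolding potential_def by measurable

text \<open>
  Young's inequality for the exponent one: the potential is a convolution with an integrable kernel.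
\<close>
lemma nn_integral_potential:
  assumes [measurable]: "f \<in> borel_measurable borel" and nn: "\<And>y. f y \<ge> 0"
  shows "(\<integral>\<^sup>+x. potential f x \<partial>lborel) \<le> ennreal (2 * unit_ball_vol 4) * (\<integral>\<^sup>+y. ennreal (f y) \<partial>lborel)"
proof -
  have "(\<integral>\<^sup>+x. potential f x \<partial>lborel) = (\<integral>\<^sup>+y. \<integral>\<^sup>+x. ennreal (newton_kernel (y - x) * f y) \<partial>lborel \<partial>lborel)"
    unfolding potential_def by (rule lborel_pair.Fubini'[symmetric]) measurable
  also have "\<dots> = (\<integral>\<^sup>+y. ennreal (f y) * (\<integral>\<^sup>+x. ennreal (newton_kernel x) \<partial>lborel) \<partial>lborel)"
  proof (rule nn_integral_cong)
    fix y
    have "(\<integral>\<^sup>+x. ennreal (newton_kernel (y - x) * f y) \<partial>lborel) = ennreal (f y) * (\<integral>\<^sup>+x. ennreal (newton_kernel (y - x)) \<partial>lborel)"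
      using nn newton_kernel_nonneg by (subst nn_integral_cmult[symmetric]) (auto simp: ennreal_mult mult.commute)
    also have "(\<integral>\<^sup>+x. ennreal (newton_kernel (y - x)) \<partial>lborel) = (\<integral>\<^sup>+x. ennreal (newton_kernel x) \<partial>lborel)"
      using nn_integral_lborel_affine[of "\<lambda>x. ennreal (newton_kernel x)" "-1" y] by simp
    finally show "(\<integral>\<^sup>+x. ennreal (newton_kernel (y - x) * f y) \<partial>lborel) = ennreal (f y) * (\<integral>\<^sup>+x. ennreal (newton_kernel x) \<partial>lborel)" .
  qed
  also have "\<dots> \<le> (\<integral>\<^sup>+y. ennreal (f y) * ennreal (2 * unit_ball_vol 4) \<partial>lborel)"
    by (intro nn_integral_mono mult_left_mono nn_integral_newton_kernel) simp
  also have "\<dots> = ennreal (2 * unit_ball_vol 4) * (\<integral>\<^sup>+y. ennreal (f y) \<partial>lborel)"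
    by (simp add: nn_integral_multc mult.commute)
  finally show ?thesis .
qed

lemma potential_le_const:
  assumes "\<And>y. f y \<le> N" "N \<ge> 0"
  shows "potential f x \<le> ennreal (2 * unit_ball_vol 4 * N)"
proof -
  have "potential f x \<le> (\<integral>\<^sup>+y. ennreal N * ennreal (newton_kernel (y - x)) \<partial>lborel)"
    unfolding potential_def using assms newton_kernel_nonneg
    by (intro nn_integral_mono) (auto simp: ennreal_mult[symmetric] mult.commute[of _ "f _"] intro!: ennreal_leI mult_right_mono)
  also have "\<dots> = ennreal N * (\<integral>\<^sup>+y. ennreal (newton_kernel y) \<partial>lborel)"
    using nn_integral_lborel_affine[of "\<lambda>x. ennreal (newton_kernel x)" 1 "- x"]
    by (simp add: nn_integral_cmult)
  also have "\<dots> \<le> ennreal N * ennreal (2 * unit_ball_vol 4)"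
    by (intro mult_left_mono nn_integral_newton_kernel) simp
  finally show ?thesis using assms by (simp add: ennreal_mult[symmetric] mult.commute)
qed

text \<open>
  Cauchy--Schwarz after splitting the kernel with the weight \<open>1 + \<tau> / |z|\<^sup>2\<close>. The weight makes the
  square of the kernel integrable near the origin at the price of the term \<open>\<tau> (k * f\<^sup>2)\<close>; the parameter
  \<open>\<tau>\<close> is optimised pointwise afterwards.
\<close>
lemma potential_square_le:
  assumes [measurable]: "f \<in> borel_measurable borel" and nn: "\<And>y. f y \<ge> 0" and \<tau>: "\<tau> > 0"
  shows "(potential f x)\<^sup>2 \<le> ennreal (unit_ball_vol 4 * (1 + 2 * ln (1 + 1 / \<tau>))) *
     ((\<integral>\<^sup>+y. ennreal ((f y)\<^sup>2) \<partial>lborel) + ennreal \<tau> * potential (\<lambda>y. (f y)\<^sup>2) x)"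
proof -
  define A where "A z = ennreal (1 / (norm z * sqrt ((norm z)\<^sup>2 + \<tau>))) * indicator (ball 0 1) z" for z :: "real^4"
  define B where "B y = ennreal (f y * sqrt (1 + \<tau> * newton_kernel (y - x)))" for y
  have [measurable]: "(\<lambda>y. newton_kernel (y - x)) \<in> borel_measurable borel" by measurable
  have [measurable]: "A \<in> borel_measurable borel" unfolding A_def by measurable
  have [measurable]: "B \<in> borel_measurable borel" unfolding B_def by measurable
  have "potential f x = (\<integral>\<^sup>+y. A (y - x) * B y \<partial>lborel)"
    unfolding potential_def
  proof (rule nn_integral_cong)
    fix y
    show "ennreal (newton_kernel (y - x) * f y) = A (y - x) * B y"
    proof (cases "norm (y - x) < 1 \<and> y \<noteq> x")
      case True
      define r where "r = norm (y - x)"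
      have r: "r > 0" "r < 1" using True by (auto simp: r_def)
      have "1 + \<tau> / r\<^sup>2 = (r\<^sup>2 + \<tau>) / r\<^sup>2" using r by (simp add: field_simps)
      then have "sqrt (1 + \<tau> / r\<^sup>2) = sqrt (r\<^sup>2 + \<tau>) / r" using r by (simp add: real_sqrt_divide)
      moreover have "sqrt (r\<^sup>2 + \<tau>) > 0" using \<tau> by (simp add: add_nonneg_pos)
      ultimately have "1 / (r * sqrt (r\<^sup>2 + \<tau>)) * (f y * sqrt (1 + \<tau> / r\<^sup>2)) = 1 / r\<^sup>2 * f y"
        using r by (simp add: field_simps power2_eq_square)
      moreover have "indicator (ball 0 1) (y - x) = (1::ennreal)" using True by simp
      ultimately show ?thesis using True nn[of y] \<tau> r
        by (simp add: A_def B_def newton_kernel_def dist_norm ennreal_mult[symmetric] r_def[symmetric])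
    next
      case False
      then show ?thesis by (auto simp: A_def newton_kernel_def)
    qed
  qed
  then have "(potential f x)\<^sup>2 \<le> (\<integral>\<^sup>+y. (A (y - x))\<^sup>2 \<partial>lborel) * (\<integral>\<^sup>+y. (B y)\<^sup>2 \<partial>lborel)"
    using Cauchy_Schwarz_nn_integral[of "\<lambda>y. A (y - x)" lborel B] by simp
  also have "\<dots> \<le> ennreal (unit_ball_vol 4 * (1 + 2 * ln (1 + 1 / \<tau>))) *
     ((\<integral>\<^sup>+y. ennreal ((f y)\<^sup>2) \<partial>lborel) + ennreal \<tau> * potential (\<lambda>y. (f y)\<^sup>2) x)"
  proof (rule mult_mono)
    have "(\<integral>\<^sup>+y. (A (y - x))\<^sup>2 \<partial>lborel) = (\<integral>\<^sup>+z. (A z)\<^sup>2 \<partial>lborel)"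
      using nn_integral_lborel_affine[of "\<lambda>z. (A z)\<^sup>2" 1 "- x"] by simp
    also have "\<dots> = (\<integral>\<^sup>+z. ennreal (1 / ((norm z)\<^sup>2 * ((norm z)\<^sup>2 + \<tau>))) * indicator (ball 0 1) (z::real^4) \<partial>lborel)"
      using \<tau> by (intro nn_integral_cong)
        (auto simp: A_def indicator_def ennreal_power power_mult_distrib power_divide)
    also have "\<dots> \<le> ennreal (unit_ball_vol 4 * (1 + 2 * ln (1 + 1 / \<tau>)))"
      by (rule nn_integral_newton_kernel_regularised[OF \<tau>])
    finally show "(\<integral>\<^sup>+y. (A (y - x))\<^sup>2 \<partial>lborel) \<le> ennreal (unit_ball_vol 4 * (1 + 2 * ln (1 + 1 / \<tau>)))" .
    have "(B y)\<^sup>2 = ennreal ((f y)\<^sup>2) + ennreal \<tau> * ennreal (newton_kernel (y - x) * (f y)\<^sup>2)" for y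
      using nn[of y] \<tau> newton_kernel_nonneg[of "y - x"]
      by (simp add: B_def ennreal_power power_mult_distrib algebra_simps ennreal_mult[symmetric] flip: ennreal_plus)
    then have "(\<integral>\<^sup>+y. (B y)\<^sup>2 \<partial>lborel) = (\<integral>\<^sup>+y. ennreal ((f y)\<^sup>2) \<partial>lborel) + ennreal \<tau> * potential (\<lambda>y. (f y)\<^sup>2) x"
      unfolding potential_def by (simp add: nn_integral_add nn_integral_cmult)
    then show "(\<integral>\<^sup>+y. (B y)\<^sup>2 \<partial>lborel) \<le> (\<integral>\<^sup>+y. ennreal ((f y)\<^sup>2) \<partial>lborel) + ennreal \<tau> * potential (\<lambda>y. (f y)\<^sup>2) x"
      by simp
  qed auto
  finally show ?thesis .
qed

text \<open>
  The choice \<open>\<tau> = m / (m + q)\<close> makes \<open>\<tau> q \<le> m\<close> and \<open>1 / \<tau> = 1 + q / m\<close>, so the previous lemma reads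
  \<open>h\<^sup>2 \<le> 2 m V (1 + 2 ln (2 + q / m))\<close>, where \<open>V\<close> is the volume of the unit ball. The value of \<open>m\<close> is the
  one for which multiplying by \<open>b\<close> turns the coefficient of the logarithm into \<open>1\<close>.
\<close>
lemma exp_potential_le:
  assumes [measurable]: "f \<in> borel_measurable borel" and nn: "\<And>y. f y \<ge> 0" and b: "b > 0"
    and m: "m = 1 / (4 * b * unit_ball_vol 4)"
    and fm: "(\<integral>\<^sup>+y. ennreal ((f y)\<^sup>2) \<partial>lborel) \<le> ennreal m"
    and q: "potential (\<lambda>y. (f y)\<^sup>2) x = ennreal q" "q \<ge> 0"
  obtains h where "h \<ge> 0" "potential f x = ennreal h" "exp (b * h\<^sup>2) \<le> 2 * (2 + q / m)"
proof -
  let ?V = "unit_ball_vol 4 :: real"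
  have V: "?V > 0" by simp
  have m0: "m > 0" using b V by (simp add: m)
  define \<tau> where "\<tau> = m / (m + q)"
  have \<tau>: "\<tau> > 0" "\<tau> * q \<le> m" "1 / \<tau> = 1 + q / m"
    using m0 q by (simp_all add: \<tau>_def field_simps)
  have ln0: "ln (2 + q / m) \<ge> 0" using m0 q by simp
  have "(potential f x)\<^sup>2 \<le> ennreal (?V * (1 + 2 * ln (1 + 1 / \<tau>))) *
     ((\<integral>\<^sup>+y. ennreal ((f y)\<^sup>2) \<partial>lborel) + ennreal \<tau> * potential (\<lambda>y. (f y)\<^sup>2) x)"
    by (rule potential_square_le[OF assms(1) nn \<tau>(1)])
  also have "\<dots> \<le> ennreal (?V * (1 + 2 * ln (1 + 1 / \<tau>))) * (ennreal m + ennreal m)"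
    using \<tau> q unfolding q(1)
    by (intro mult_left_mono add_mono fm) (auto simp: ennreal_mult[symmetric] intro!: ennreal_leI)
  also have "\<dots> = ennreal (?V * (1 + 2 * ln (2 + q / m)) * (2 * m))"
    using m0 ln0 V by (simp add: \<tau>(3) ennreal_mult[symmetric] add.assoc[symmetric] flip: ennreal_plus)
  finally have le: "(potential f x)\<^sup>2 \<le> ennreal (?V * (1 + 2 * ln (2 + q / m)) * (2 * m))" .
  then have "(potential f x)\<^sup>2 < top" using ennreal_less_top le_less_trans by blast
  then have "potential f x \<noteq> top" by (auto simp: power2_eq_square)
  then obtain h where h: "h \<ge> 0" "potential f x = ennreal h"
    by (cases "potential f x") auto
  have "h\<^sup>2 \<le> ?V * (1 + 2 * ln (2 + q / m)) * (2 * m)"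
    using le h m0 ln0 V by (simp add: ennreal_power)
  then have "b * h\<^sup>2 \<le> b * (?V * (1 + 2 * ln (2 + q / m)) * (2 * m))"
    using b by (intro mult_left_mono) auto
  also have "\<dots> = 1 / 2 + ln (2 + q / m)"
  proof -
    have "?V \<noteq> 0" using V by linarith
    then have "4 * b * ?V * m = 1" using b by (simp add: m)
    moreover have "b * (?V * (1 + 2 * ln (2 + q / m)) * (2 * m)) = (4 * b * ?V * m) * (1 / 2 + ln (2 + q / m))"
      by (simp add: algebra_simps)
    ultimately show ?thesis by simp
  qed
  finally have "exp (b * h\<^sup>2) \<le> exp (1 / 2 + ln (2 + q / m))" by simp
  also have "\<dots> = exp (1 / 2) * (2 + q / m)"
    using m0 q by (simp add: exp_add add_pos_nonneg)
  also have "\<dots> \<le> 2 * (2 + q / m)"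
  proof (rule mult_right_mono)
    have "(exp (1 / 2 :: real))\<^sup>2 = exp 1" by (simp add: power2_eq_square flip: exp_add)
    also have "\<dots> \<le> 2\<^sup>2" using exp_le by simp
    finally show "exp (1 / 2 :: real) \<le> 2" by (rule power2_le_imp_le) simp
  qed (use m0 q in simp)
  finally show ?thesis using that h by blast
qed

section \<open>The weak Laplacian tested against regularised Newton kernels\<close>

lemma cutoff_has_derivative:
  assumes "\<delta> > 0" "s \<ge> 0"
  shows "(cutoff p m \<delta> has_real_derivative
     - cutoff (flat_deriv p) m \<delta> s - real m * cutoff p (Suc m) \<delta> s) (at s)"
proof -
  have "((\<lambda>s. flat p (1 - s)) has_real_derivative - flat (flat_deriv p) (1 - s)) (at s)"
  proof -
    have "((\<lambda>s::real. 1 - s) has_real_derivative - 1) (at s)"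
      by (auto intro!: derivative_eq_intros)
    from DERIV_chain'[OF this flat_has_derivative[of p]] show ?thesis by simp
  qed
  moreover have "((\<lambda>s. inverse (s + \<delta>) ^ m) has_real_derivative - real m * inverse (s + \<delta>) ^ Suc m) (at s)"
  proof (cases m)
    case (Suc n)
    have "((\<lambda>s. inverse (s + \<delta>)) has_real_derivative - (inverse (s + \<delta>) * inverse (s + \<delta>))) (at s)"
      using assms by (auto intro!: derivative_eq_intros)
    from DERIV_power[OF this, of m] show ?thesis
      by (simp add: Suc algebra_simps)
  qed simp
  ultimately have "((\<lambda>s. flat p (1 - s) * inverse (s + \<delta>) ^ m) has_real_derivative
     flat p (1 - s) * (- real m * inverse (s + \<delta>) ^ Suc m) + - flat (flat_deriv p) (1 - s) * inverse (s + \<delta>) ^ m) (at s)"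
    by (rule DERIV_mult')
  then show ?thesis unfolding cutoff_def[abs_def] divide_inverse power_inverse
    by (simp add: algebra_simps del: power_Suc)
qed

lemma cutoff_Suc: "\<delta> > 0 \<Longrightarrow> s \<ge> 0 \<Longrightarrow> cutoff p m \<delta> s = (s + \<delta>) * cutoff p (Suc m) \<delta> s"
  by (simp add: cutoff_def)

lemma cutoff_continuous:
  fixes a :: "'a::euclidean_space"
  assumes "\<delta> > 0"
  shows "continuous_on UNIV (\<lambda>y. cutoff p m \<delta> ((norm (y - a))\<^sup>2))"
  using test_function_cutoff[OF assms] C_k_imp_continuous unfolding test_function_def by blast

lemma cutoff_eq_0: "s \<ge> 1 \<Longrightarrow> cutoff p m \<delta> s = 0"
  by (simp add: cutoff_def flat_def)

lemma flat_bounded: "\<exists>M\<ge>0. \<forall>s\<ge>0. \<bar>flat p (1 - s)\<bar> \<le> M"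
proof -
  have "continuous_on {0..1} (flat p)"
    by (meson DERIV_continuous_on flat_has_derivative has_field_derivative_at_within)
  then have "bounded (flat p ` {0..1})" by (intro compact_imp_bounded compact_continuous_image) auto
  then obtain M where M: "\<And>t. t \<in> {0..1} \<Longrightarrow> \<bar>flat p t\<bar> \<le> M"
    unfolding bounded_iff by (auto simp: image_iff) (metis atLeastAtMost_iff)
  have "M \<ge> 0" using M[of 0] by auto
  moreover have "\<bar>flat p (1 - s)\<bar> \<le> M" if "s \<ge> 0" for s
    using M[of "1 - s"] that \<open>M \<ge> 0\<close> by (cases "s \<le> 1") (auto simp: flat_def)
  ultimately show ?thesis by blast
qed

lemma second_deriv_cutoff:
  fixes a :: "'a::euclidean_space"
  assumes "\<delta> > 0"
  shows "iter_partial_deriv [b, b] (\<lambda>y. cutoff 1 1 \<delta> ((norm (y - a))\<^sup>2)) y =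
    (4 * cutoff (flat_deriv (flat_deriv 1)) 1 \<delta> ((norm (y - a))\<^sup>2)
      + 8 * cutoff (flat_deriv 1) 2 \<delta> ((norm (y - a))\<^sup>2)
      + 8 * cutoff 1 3 \<delta> ((norm (y - a))\<^sup>2)) * ((y - a) \<bullet> b)\<^sup>2
    - 2 * (cutoff (flat_deriv 1) 1 \<delta> ((norm (y - a))\<^sup>2) + cutoff 1 2 \<delta> ((norm (y - a))\<^sup>2)) * (b \<bullet> b)"
proof -
  define F1 where "F1 s = - cutoff (flat_deriv 1) 1 \<delta> s - cutoff 1 2 \<delta> s" for s
  define F2 where "F2 s = cutoff (flat_deriv (flat_deriv 1)) 1 \<delta> s
     + 2 * cutoff (flat_deriv 1) 2 \<delta> s + 2 * cutoff 1 3 \<delta> s" for s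
  have D1: "(cutoff 1 1 \<delta> has_real_derivative F1 s) (at s)" if "s \<ge> 0" for s
    using cutoff_has_derivative[OF assms that, of 1 1] by (simp add: F1_def numeral_2_eq_2)
  have D2: "(F1 has_real_derivative F2 s) (at s)" if "s \<ge> 0" for s
    unfolding F1_def[abs_def] F2_def
    by (rule derivative_eq_intros cutoff_has_derivative[OF assms that] refl)+
       (simp add: eval_nat_numeral)
  show ?thesis
    by (subst iter_partial_deriv2_radial[OF D1 D2])
       (simp_all only: F1_def F2_def algebra_simps)
qed

text \<open>
  For \<open>F(|x|\<^sup>2)\<close> in dimension four the Laplacian is \<open>4 s F'' + 8 F'\<close>. For \<open>F = 1 / (s + \<delta>)\<close> this is
  \<open>- 8 \<delta> / (s + \<delta>)\<^sup>3\<close>, an approximate identity up to sign and a constant factor; the other two terms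
  come from derivatives that fall on the bump.
\<close>
lemma laplacian_cutoff:
  fixes a :: "real^4"
  assumes "\<delta> > 0"
  shows "(\<Sum>b\<in>Basis. iter_partial_deriv [b, b] (\<lambda>y. cutoff 1 1 \<delta> ((norm (y - a))\<^sup>2)) y) =
    - 8 * \<delta> * cutoff 1 3 \<delta> ((norm (y - a))\<^sup>2)
    - 8 * \<delta> * cutoff (flat_deriv 1) 2 \<delta> ((norm (y - a))\<^sup>2)
    + 4 * (norm (y - a))\<^sup>2 * cutoff (flat_deriv (flat_deriv 1)) 1 \<delta> ((norm (y - a))\<^sup>2)"
proof -
  let ?s = "(norm (y - a))\<^sup>2"
  have norm: "(\<Sum>b\<in>Basis. ((y - a) \<bullet> b)\<^sup>2) = ?s"
    unfolding power2_norm_eq_inner by (subst euclidean_inner) (simp add: power2_eq_square)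
  have dim: "(\<Sum>b\<in>Basis. (b::real^4) \<bullet> b) = 4"
    by simp
  show ?thesis
    unfolding second_deriv_cutoff[OF assms] sum_subtractf sum_distrib_left[symmetric] norm dim
    using cutoff_Suc[OF assms, of ?s "flat_deriv 1" 1] cutoff_Suc[OF assms, of ?s 1 2]
    by (simp add: eval_nat_numeral algebra_simps)
qed

lemma L2_measurable: "u \<in> L2 \<Longrightarrow> u \<in> borel_measurable borel"
  by (simp add: L2_def)

lemma L2_mult_integrable:
  fixes u v :: "'a::euclidean_space \<Rightarrow> real"
  assumes "u \<in> L2" "v \<in> L2"
  shows "integrable lborel (\<lambda>x. u x * v x)"
proof (rule Bochner_Integration.integrable_bound)
  show "integrable lborel (\<lambda>x. (u x)\<^sup>2 + (v x)\<^sup>2)" using assms by (simp add: L2_def)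
  have "\<bar>a * b\<bar> \<le> a\<^sup>2 + b\<^sup>2" for a b :: real
  proof -
    have "2 * (\<bar>a\<bar> * \<bar>b\<bar>) \<le> a\<^sup>2 + b\<^sup>2" using sum_squares_bound[of "\<bar>a\<bar>" "\<bar>b\<bar>"] by (simp add: mult.assoc)
    moreover have "0 \<le> \<bar>a\<bar> * \<bar>b\<bar>" by simp
    ultimately show ?thesis unfolding abs_mult by linarith
  qed
  then show "AE x in lborel. norm (u x * v x) \<le> norm ((u x)\<^sup>2 + (v x)\<^sup>2)" by simp
qed (use assms[THEN L2_measurable] in simp)

lemma L2_add: "u \<in> L2 \<Longrightarrow> v \<in> L2 \<Longrightarrow> (\<lambda>x. u x + v x) \<in> L2"
  using L2_mult_integrable[of u v] unfolding L2_def
  by (auto simp: power2_sum mult.assoc intro!: Bochner_Integration.integrable_add)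

lemma L2_cmult: "u \<in> L2 \<Longrightarrow> (\<lambda>x. c * u x) \<in> L2"
  unfolding L2_def by (auto simp: power_mult_distrib)

lemma L2_zero: "(\<lambda>x. 0) \<in> L2"
  by (simp add: L2_def)

lemma L2_sum: "finite A \<Longrightarrow> (\<And>b. b \<in> A \<Longrightarrow> f b \<in> L2) \<Longrightarrow> (\<lambda>x. \<Sum>b\<in>A. f b x) \<in> L2"
  by (induction A rule: finite_induct) (auto intro: L2_zero L2_add)

lemma L2_continuous_compact_support:
  assumes "continuous_on UNIV f" "\<And>x. x \<notin> T \<Longrightarrow> f x = 0" "compact T"
  shows "f \<in> L2"
proof -
  have "integrable lborel (\<lambda>x. indicator T x *\<^sub>R (f x)\<^sup>2)"
    using assms by (intro borel_integrable_compact) (auto intro!: continuous_intros elim: continuous_on_subset)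
  moreover have "(\<lambda>x. indicator T x *\<^sub>R (f x)\<^sup>2) = (\<lambda>x. (f x)\<^sup>2)"
    using assms(2) by (auto simp: fun_eq_iff indicator_def)
  ultimately show ?thesis
    using borel_measurable_continuous_onI[OF assms(1)] by (simp add: L2_def)
qed

lemma cutoff_L2:
  fixes a :: "'a::euclidean_space"
  assumes "\<delta> > 0" "continuous_on UNIV g"
  shows "(\<lambda>y. g y * cutoff p m \<delta> ((norm (y - a))\<^sup>2)) \<in> L2"
proof (rule L2_continuous_compact_support[where T = "cball a 1"])
  fix y assume "y \<notin> cball a 1"
  then have "(norm (y - a))\<^sup>2 \<ge> 1" by (simp add: dist_norm norm_minus_commute)
  then show "g y * cutoff p m \<delta> ((norm (y - a))\<^sup>2) = 0" by (simp add: cutoff_eq_0)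
qed (intro continuous_on_mult assms cutoff_continuous, simp)

lemma weak_partial_deriv_props:
  assumes "u \<in> sobolev_H k" "set bs \<subseteq> Basis" "length bs \<le> k"
  shows "weak_partial_deriv bs u \<in> L2" "has_weak_partial_deriv u bs (weak_partial_deriv bs u)"
proof -
  have "\<exists>v. v \<in> L2 \<and> has_weak_partial_deriv u bs v" using assms unfolding sobolev_H_def by blast
  from someI_ex[OF this] show "weak_partial_deriv bs u \<in> L2" "has_weak_partial_deriv u bs (weak_partial_deriv bs u)"
    unfolding weak_partial_deriv_def by auto
qed

lemma weak_laplacian_L2: "u \<in> sobolev_H 2 \<Longrightarrow> weak_laplacian u \<in> L2"
  unfolding weak_laplacian_def by (intro L2_sum weak_partial_deriv_props(1)) auto

text \<open>
  The definition of the weak derivatives, tested against the regularised Newton kernel and summed over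
  the coordinates, with the approximate identity isolated on the left.
\<close>
lemma weak_laplacian_cutoff_identity:
  fixes u :: "real^4 \<Rightarrow> real"
  assumes u: "u \<in> sobolev_H 2" and d: "\<delta> > 0"
  shows "(\<integral>y. u y * (8 * \<delta> * cutoff 1 3 \<delta> ((norm (y - a))\<^sup>2)) \<partial>lborel) =
    (\<integral>y. u y * ((- 8 * \<delta>) * cutoff (flat_deriv 1) 2 \<delta> ((norm (y - a))\<^sup>2)
          + 4 * (norm (y - a))\<^sup>2 * cutoff (flat_deriv (flat_deriv 1)) 1 \<delta> ((norm (y - a))\<^sup>2))
        - weak_laplacian u y * cutoff 1 1 \<delta> ((norm (y - a))\<^sup>2) \<partial>lborel)"
proof -
  let ?s = "\<lambda>y. (norm (y - a))\<^sup>2"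
  let ?\<phi> = "\<lambda>y. cutoff 1 1 \<delta> (?s y)"
  let ?E = "\<lambda>y. (- 8 * \<delta>) * cutoff (flat_deriv 1) 2 \<delta> (?s y)
          + 4 * ?s y * cutoff (flat_deriv (flat_deriv 1)) 1 \<delta> (?s y)"
  let ?R = "\<lambda>y. (8 * \<delta>) * cutoff 1 3 \<delta> (?s y)"
  have uL: "u \<in> L2" using u by (simp add: sobolev_H_def)
  have RL: "?R \<in> L2" by (intro cutoff_L2 d continuous_intros)
  have EL: "?E \<in> L2" by (intro L2_add cutoff_L2 d continuous_intros)
  have \<phi>L: "?\<phi> \<in> L2" using cutoff_L2[OF d, of "\<lambda>_. 1" 1 1 a] by simp
  have int: "integrable lborel (\<lambda>y. u y * iter_partial_deriv [b, b] ?\<phi> y)" if "b \<in> Basis" for b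
  proof -
    have "iter_partial_deriv [b, b] ?\<phi> = (\<lambda>y.
        (4 * ((y - a) \<bullet> b)\<^sup>2) * cutoff (flat_deriv (flat_deriv 1)) 1 \<delta> (?s y)
      + (8 * ((y - a) \<bullet> b)\<^sup>2) * cutoff (flat_deriv 1) 2 \<delta> (?s y)
      + (8 * ((y - a) \<bullet> b)\<^sup>2) * cutoff 1 3 \<delta> (?s y)
      + (- 2 * (b \<bullet> b)) * cutoff (flat_deriv 1) 1 \<delta> (?s y)
      + (- 2 * (b \<bullet> b)) * cutoff 1 2 \<delta> (?s y))"
      by (rule ext, subst second_deriv_cutoff[OF d]) (simp only: algebra_simps)
    also have "\<dots> \<in> L2" by (intro L2_add cutoff_L2 d continuous_intros)
    finally show ?thesis by (rule L2_mult_integrable[OF uL])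
  qed
  have wL: "weak_partial_deriv [b, b] u \<in> L2" if "b \<in> Basis" for b
    using weak_partial_deriv_props(1)[OF u, of "[b, b]"] that by simp
  have "(\<integral>y. weak_laplacian u y * ?\<phi> y \<partial>lborel) = (\<integral>y. (\<Sum>b\<in>Basis. weak_partial_deriv [b, b] u y * ?\<phi> y) \<partial>lborel)"
    by (simp add: weak_laplacian_def sum_distrib_right)
  also have "\<dots> = (\<Sum>b\<in>Basis. \<integral>y. weak_partial_deriv [b, b] u y * ?\<phi> y \<partial>lborel)"
    by (intro Bochner_Integration.integral_sum L2_mult_integrable wL \<phi>L)
  also have "\<dots> = (\<Sum>b\<in>Basis. \<integral>y. u y * iter_partial_deriv [b, b] ?\<phi> y \<partial>lborel)"
  proof (rule sum.cong)
    fix b :: "real^4" assume b: "b \<in> Basis"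
    have "has_weak_partial_deriv u [b, b] (weak_partial_deriv [b, b] u)"
      using b by (intro weak_partial_deriv_props(2)[OF u]) auto
    then show "(\<integral>y. weak_partial_deriv [b, b] u y * ?\<phi> y \<partial>lborel) = (\<integral>y. u y * iter_partial_deriv [b, b] ?\<phi> y \<partial>lborel)"
      using test_function_cutoff[OF d, of 1 1 a] unfolding has_weak_partial_deriv_def
      by (simp del: iter_partial_deriv.simps)
  qed simp
  also have "\<dots> = (\<integral>y. (\<Sum>b\<in>Basis. u y * iter_partial_deriv [b, b] ?\<phi> y) \<partial>lborel)"
    by (intro Bochner_Integration.integral_sum[symmetric] int)
  also have "\<dots> = (\<integral>y. u y * ?E y - u y * ?R y \<partial>lborel)"
    unfolding sum_distrib_left[symmetric] laplacian_cutoff[OF d]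
    by (intro Bochner_Integration.integral_cong) (simp_all add: algebra_simps)
  also have "\<dots> = (\<integral>y. u y * ?E y \<partial>lborel) - (\<integral>y. u y * ?R y \<partial>lborel)"
    by (intro Bochner_Integration.integral_diff L2_mult_integrable uL EL RL)
  finally have "(\<integral>y. u y * ?R y \<partial>lborel) = (\<integral>y. u y * ?E y \<partial>lborel) - (\<integral>y. weak_laplacian u y * ?\<phi> y \<partial>lborel)"
    by simp
  also have "\<dots> = (\<integral>y. u y * ?E y - weak_laplacian u y * ?\<phi> y \<partial>lborel)"
    by (intro Bochner_Integration.integral_diff[symmetric] L2_mult_integrable uL EL \<phi>L weak_laplacian_L2 u)
  finally show ?thesis by simp
qed

lemma abs_integral_le_nn_integral:
  fixes f :: "'a \<Rightarrow> real"
  shows "ennreal \<bar>integral\<^sup>L M f\<bar> \<le> (\<integral>\<^sup>+x. ennreal \<bar>f x\<bar> \<partial>M)"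
proof (cases "integrable M f")
  case True
  then show ?thesis using integral_norm_bound_ennreal[of M f] by simp
qed (simp add: not_integrable_integral_eq)

text \<open>
  Every term on the right of the preceding identity is dominated by the Newton kernel, uniformly in the
  regularisation parameter.
\<close>
lemma mollification_bound:
  "\<exists>C\<ge>0. \<forall>u\<in>sobolev_H 2. \<forall>\<delta>>0. \<forall>a::real^4.
     ennreal \<bar>\<integral>y. u y * (8 * \<delta> * cutoff 1 3 \<delta> ((norm (y - a))\<^sup>2)) \<partial>lborel\<bar> \<le>
     ennreal C * (\<integral>\<^sup>+y. ennreal (newton_kernel (y - a) * (\<bar>u y\<bar> + \<bar>weak_laplacian u y\<bar>)) \<partial>lborel)"
proof -
  obtain M0 M1 M2 where M: "M0 \<ge> 0" "M1 \<ge> 0" "M2 \<ge> 0" and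
    M0: "\<And>s. s \<ge> 0 \<Longrightarrow> \<bar>flat 1 (1 - s)\<bar> \<le> M0" and
    M1: "\<And>s. s \<ge> 0 \<Longrightarrow> \<bar>flat (flat_deriv 1) (1 - s)\<bar> \<le> M1" and
    M2: "\<And>s. s \<ge> 0 \<Longrightarrow> \<bar>flat (flat_deriv (flat_deriv 1)) (1 - s)\<bar> \<le> M2"
    using flat_bounded[of 1] flat_bounded[of "flat_deriv 1"] flat_bounded[of "flat_deriv (flat_deriv 1)"] by metis
  define C where "C = M0 + 8 * M1 + 4 * M2"
  have C: "C \<ge> 0" using M by (simp add: C_def)
  show ?thesis
  proof (intro exI[of _ C] conjI C ballI allI impI)
    fix u :: "real^4 \<Rightarrow> real" and \<delta> :: real and a :: "real^4"
    assume u: "u \<in> sobolev_H 2" and d: "\<delta> > 0"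
    have [measurable]: "u \<in> borel_measurable borel" "weak_laplacian u \<in> borel_measurable borel"
      using u weak_laplacian_L2[OF u] by (auto simp: sobolev_H_def L2_measurable)
    let ?G = "\<lambda>y. u y * ((- 8 * \<delta>) * cutoff (flat_deriv 1) 2 \<delta> ((norm (y - a))\<^sup>2)
          + 4 * (norm (y - a))\<^sup>2 * cutoff (flat_deriv (flat_deriv 1)) 1 \<delta> ((norm (y - a))\<^sup>2))
        - weak_laplacian u y * cutoff 1 1 \<delta> ((norm (y - a))\<^sup>2)"
    have bd: "\<bar>?G y\<bar> \<le> C * (newton_kernel (y - a) * (\<bar>u y\<bar> + \<bar>weak_laplacian u y\<bar>))" if "y \<noteq> a" for y
    proof (cases "norm (y - a) < 1")
      case False
      then have "(norm (y - a))\<^sup>2 \<ge> 1" by simp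
      then show ?thesis using C by (simp add: cutoff_eq_0 newton_kernel_nonneg)
    next
      case True
      define s where "s = (norm (y - a))\<^sup>2"
      have s: "s > 0" "s < 1" using True that by (auto simp: s_def power_less_one_iff)
      have a: "\<bar>cutoff 1 1 \<delta> s\<bar> \<le> M0 / s"
      proof -
        have "\<bar>cutoff 1 1 \<delta> s\<bar> = \<bar>flat 1 (1 - s)\<bar> / (s + \<delta>)" using s d by (simp add: cutoff_def)
        also have "\<dots> \<le> M0 / s" using s d M M0[of s] by (intro frac_le) auto
        finally show ?thesis .
      qed
      have b: "\<bar>(- 8 * \<delta>) * cutoff (flat_deriv 1) 2 \<delta> s\<bar> \<le> 8 * M1 / s"
      proof -
        have "\<bar>(- 8 * \<delta>) * cutoff (flat_deriv 1) 2 \<delta> s\<bar> = 8 * \<bar>flat (flat_deriv 1) (1 - s)\<bar> * (\<delta> / (s + \<delta>)\<^sup>2)"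
          using s d by (simp add: cutoff_def abs_mult)
        also have "\<dots> \<le> 8 * M1 * (1 / s)"
        proof (rule mult_mono)
          have "\<delta> * s \<le> (s + \<delta>)\<^sup>2" using s d by (simp add: power2_eq_square algebra_simps)
          then show "\<delta> / (s + \<delta>)\<^sup>2 \<le> 1 / s" using s d by (simp add: divide_simps)
        qed (use s d M M1[of s] in auto)
        finally show ?thesis by simp
      qed
      have c: "\<bar>4 * s * cutoff (flat_deriv (flat_deriv 1)) 1 \<delta> s\<bar> \<le> 4 * M2 / s"
      proof -
        have "\<bar>4 * s * cutoff (flat_deriv (flat_deriv 1)) 1 \<delta> s\<bar>
            = 4 * \<bar>flat (flat_deriv (flat_deriv 1)) (1 - s)\<bar> * (s / (s + \<delta>))"
          using s d by (simp add: cutoff_def abs_mult)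
        also have "\<dots> \<le> 4 * M2 * (1 / s)"
        proof (rule mult_mono)
          have "s * s \<le> s + \<delta>" using mult_left_le[of s s] s d by linarith
          then show "s / (s + \<delta>) \<le> 1 / s" using s d by (simp add: divide_simps)
        qed (use s d M M2[of s] in auto)
        finally show ?thesis by simp
      qed
      let ?A = "(- 8 * \<delta>) * cutoff (flat_deriv 1) 2 \<delta> s"
      let ?B = "4 * s * cutoff (flat_deriv (flat_deriv 1)) 1 \<delta> s"
      have "\<bar>?G y\<bar> \<le> \<bar>u y * (?A + ?B)\<bar> + \<bar>weak_laplacian u y * cutoff 1 1 \<delta> s\<bar>"
        unfolding s_def[symmetric] by (rule abs_triangle_ineq4)
      also have "\<dots> = \<bar>u y\<bar> * \<bar>?A + ?B\<bar> + \<bar>weak_laplacian u y\<bar> * \<bar>cutoff 1 1 \<delta> s\<bar>"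
        by (simp only: abs_mult)
      also have "\<dots> \<le> \<bar>u y\<bar> * (8 * M1 / s + 4 * M2 / s) + \<bar>weak_laplacian u y\<bar> * (M0 / s)"
        using b c by (intro add_mono mult_left_mono a) linarith+
      also have "\<dots> \<le> \<bar>u y\<bar> * (C / s) + \<bar>weak_laplacian u y\<bar> * (C / s)"
        using s M by (intro add_mono mult_left_mono) (auto simp: C_def divide_simps)
      also have "\<dots> = C * (newton_kernel (y - a) * (\<bar>u y\<bar> + \<bar>weak_laplacian u y\<bar>))"
        using True by (simp add: newton_kernel_def s_def algebra_simps add_divide_distrib)
      finally show ?thesis .
    qed
    have "ennreal \<bar>\<integral>y. u y * (8 * \<delta> * cutoff 1 3 \<delta> ((norm (y - a))\<^sup>2)) \<partial>lborel\<bar> \<le> (\<integral>\<^sup>+y. ennreal \<bar>?G y\<bar> \<partial>lborel)"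
      unfolding weak_laplacian_cutoff_identity[OF u d] by (rule abs_integral_le_nn_integral)
    also have "\<dots> \<le> (\<integral>\<^sup>+y. ennreal (C * (newton_kernel (y - a) * (\<bar>u y\<bar> + \<bar>weak_laplacian u y\<bar>))) \<partial>lborel)"
    proof (rule nn_integral_mono_AE)
      have "AE y in lborel. y \<noteq> a" by (rule AE_lborel_singleton)
      then show "AE y in lborel. ennreal \<bar>?G y\<bar> \<le> ennreal (C * (newton_kernel (y - a) * (\<bar>u y\<bar> + \<bar>weak_laplacian u y\<bar>)))"
        by eventually_elim (use bd in \<open>auto intro!: ennreal_leI\<close>)
    qed
    also have "\<dots> = ennreal C * (\<integral>\<^sup>+y. ennreal (newton_kernel (y - a) * (\<bar>u y\<bar> + \<bar>weak_laplacian u y\<bar>)) \<partial>lborel)"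
      using C by (simp add: ennreal_mult' nn_integral_cmult)
    finally show "ennreal \<bar>\<integral>y. u y * (8 * \<delta> * cutoff 1 3 \<delta> ((norm (y - a))\<^sup>2)) \<partial>lborel\<bar> \<le>
     ennreal C * (\<integral>\<^sup>+y. ennreal (newton_kernel (y - a) * (\<bar>u y\<bar> + \<bar>weak_laplacian u y\<bar>)) \<partial>lborel)" .
  qed
qed

section \<open>Almost everywhere bounds from mollified bounds\<close>

text \<open>
  The singular part of the Laplacian of the regularised Newton kernel. Its total mass is not one and
  depends on \<open>\<delta>\<close>, but it stays above a positive constant, and that is all an upper bound needs.
\<close>
definition mollifier :: "real \<Rightarrow> real^4 \<Rightarrow> real" where
  "mollifier \<delta> z = 8 * \<delta> * cutoff 1 3 \<delta> ((norm z)\<^sup>2)"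

lemma flat_1_bounds: "0 \<le> flat 1 t" "flat 1 t \<le> 1"
  by (auto simp: flat_def)

lemma mollifier_nonneg: "\<delta> > 0 \<Longrightarrow> mollifier \<delta> z \<ge> 0"
  using flat_1_bounds by (simp add: mollifier_def cutoff_def)

lemma mollifier_eq_0: "norm z \<ge> 1 \<Longrightarrow> mollifier \<delta> z = 0"
  by (simp add: mollifier_def cutoff_eq_0)

lemma mollifier_continuous: "\<delta> > 0 \<Longrightarrow> continuous_on UNIV (mollifier \<delta>)"
  using cutoff_continuous[of \<delta> 1 3 0] unfolding mollifier_def[abs_def]
  by (auto intro!: continuous_intros)

lemma mollifier_measurable [measurable]: "\<delta> > 0 \<Longrightarrow> mollifier \<delta> \<in> borel_measurable borel"
  by (intro borel_measurable_continuous_onI mollifier_continuous)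

lemma mollifier_L2: "\<delta> > 0 \<Longrightarrow> (\<lambda>y. mollifier \<delta> (x - y)) \<in> L2"
  unfolding mollifier_def norm_minus_commute[of x] by (rule cutoff_L2) auto

lemma mollifier_integrable: "\<delta> > 0 \<Longrightarrow> integrable lborel (\<lambda>y. mollifier \<delta> (x - y))"
proof -
  assume d: "\<delta> > 0"
  have "integrable lborel (\<lambda>y. indicator (cball x 1) y *\<^sub>R mollifier \<delta> (x - y))"
    using mollifier_continuous[OF d] by (intro borel_integrable_compact)
      (auto intro!: continuous_on_compose2[of UNIV "mollifier \<delta>"] continuous_intros)
  moreover have "(\<lambda>y. indicator (cball x 1) y *\<^sub>R mollifier \<delta> (x - y)) = (\<lambda>y. mollifier \<delta> (x - y))"
    by (auto simp: fun_eq_iff indicator_def mollifier_eq_0 dist_norm)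
  ultimately show ?thesis by simp
qed

definition mollifier_mass :: "real \<Rightarrow> real" where
  "mollifier_mass \<delta> = (\<integral>z. mollifier \<delta> (0 - z) \<partial>lborel)"

lemma mollifier_mass_eq:
  assumes "\<delta> > 0" shows "(\<integral>y. mollifier \<delta> (x - y) \<partial>lborel) = mollifier_mass \<delta>"
proof -
  have "(\<integral>y. mollifier \<delta> (x - y) \<partial>lborel) = (\<integral>y. mollifier \<delta> (0 - y) \<partial>distr lborel borel ((+) (- x)))"
    using assms by (subst integral_distr) auto
  then show ?thesis by (simp add: lborel_distr_plus mollifier_mass_def)
qed

text \<open>
  On the ball of radius \<open>sqrt \<delta> / 2\<close> the mollifier is at least \<open>exp(-2) / \<delta>\<^sup>2\<close>.
\<close>
lemma mollifier_mass_ge: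
  assumes "0 < \<delta>" "\<delta> \<le> 1"
  shows "mollifier_mass \<delta> \<ge> exp (- 2) * unit_ball_vol 4 / 16"
proof -
  let ?c = "exp (- 2) / \<delta>\<^sup>2" and ?r = "sqrt \<delta> / 2"
  have "ennreal (exp (- 2) * unit_ball_vol 4 / 16) = (\<integral>\<^sup>+z. ennreal ?c * indicator (cball 0 ?r) (z::real^4) \<partial>lborel)"
  proof -
    have "sqrt \<delta> ^ 4 = ((sqrt \<delta>)\<^sup>2)\<^sup>2" by (simp flip: power_mult)
    then have r4: "?r ^ 4 = \<delta>\<^sup>2 / 16" using assms by (simp add: power_divide)
    have "exp (- 2) * unit_ball_vol 4 / 16 = ?c * (unit_ball_vol 4 * ?r ^ 4)" unfolding r4 using assms by simp
    then show ?thesis using assms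
      by (simp add: nn_integral_cmult_indicator emeasure_cball ennreal_mult[symmetric])
  qed
  also have "\<dots> \<le> (\<integral>\<^sup>+z. ennreal (mollifier \<delta> (0 - z)) \<partial>lborel)"
  proof (rule nn_integral_mono)
    fix z :: "real^4"
    show "ennreal ?c * indicator (cball 0 ?r) z \<le> ennreal (mollifier \<delta> (0 - z))"
    proof (cases "z \<in> cball 0 ?r")
      case True
      define s where "s = (norm z)\<^sup>2"
      have "s \<le> ?r\<^sup>2" unfolding s_def using True by (intro power_mono) auto
      then have s: "0 \<le> s" "s \<le> \<delta> / 4" "s \<le> 1 / 4" using assms by (auto simp: s_def power_divide)
      have "1 / (1 - s) \<le> 2" using s by (simp add: divide_simps)
      then have "exp (- 2) \<le> flat 1 (1 - s)" using s by (simp add: flat_def)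
      moreover have "(s + \<delta>) ^ 3 \<le> (2 * \<delta>) ^ 3" using s assms by (intro power_mono) auto
      ultimately have "8 * \<delta> * (exp (- 2) / (2 * \<delta>) ^ 3) \<le> 8 * \<delta> * (flat 1 (1 - s) / (s + \<delta>) ^ 3)"
        using assms s by (intro mult_left_mono frac_le) (auto simp: flat_1_bounds)
      moreover have "8 * \<delta> * (exp (- 2) / (2 * \<delta>) ^ 3) = ?c" using assms by (simp add: field_simps eval_nat_numeral)
      ultimately have "?c \<le> mollifier \<delta> (0 - z)" by (simp add: mollifier_def cutoff_def s_def)
      then show ?thesis using True by (auto intro: ennreal_leI)
    qed simp
  qed
  also have "\<dots> = ennreal (mollifier_mass \<delta>)"
    unfolding mollifier_mass_def using assms mollifier_nonneg
    by (intro nn_integral_eq_integral mollifier_integrable) auto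
  finally have "ennreal (exp (- 2) * unit_ball_vol 4 / 16) \<le> ennreal (mollifier_mass \<delta>)" .
  moreover have "0 < exp (- 2) * unit_ball_vol 4 / 16" by simp
  ultimately show ?thesis unfolding ennreal_le_iff2 by linarith
qed

lemma mollifier_le:
  assumes "\<delta> > 0" "r > 0" "norm z \<ge> r"
  shows "mollifier \<delta> z \<le> 8 * \<delta> / r ^ 6 * indicator (cball 0 1) z"
proof (cases "norm z \<ge> 1")
  case False
  have "r ^ 6 = (r\<^sup>2) ^ 3" by (simp flip: power_mult)
  also have "\<dots> \<le> ((norm z)\<^sup>2 + \<delta>) ^ 3" using assms
    by (intro power_mono) (auto intro: add_increasing2 power_mono)
  finally have "8 * \<delta> * (flat 1 (1 - (norm z)\<^sup>2) / ((norm z)\<^sup>2 + \<delta>) ^ 3) \<le> 8 * \<delta> * (1 / r ^ 6)"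
    using assms by (intro mult_left_mono frac_le) (auto simp: flat_1_bounds)
  then show ?thesis using False by (simp add: mollifier_def cutoff_def)
qed (use assms in \<open>simp add: mollifier_eq_0\<close>)

lemma L2_integrable_cball:
  fixes w :: "'a::euclidean_space \<Rightarrow> real"
  assumes "w \<in> L2"
  shows "integrable lborel (\<lambda>y. \<bar>w y\<bar> * indicator (cball 0 R) y)"
proof -
  have "(\<lambda>y::'a. indicator (cball 0 R) y :: real) \<in> L2"
  proof -
    have "integrable lborel (indicator (cball 0 R) :: 'a \<Rightarrow> real)"
      by (intro integrable_real_indicator emeasure_lborel_cball_finite) auto
    then show ?thesis
      by (simp add: L2_def power2_eq_square borel_measurable_indicator flip: indicator_inter_arith)
  qed
  moreover have "(\<lambda>y. \<bar>w y\<bar>) \<in> L2" using assms by (auto simp: L2_def)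
  ultimately show ?thesis using L2_mult_integrable by blast
qed

text \<open>
  Let \<open>\<rho>\<close> be a mollifier of mass \<open>m\<close>. Then \<open>(\<rho> * \<phi>) / m\<close> is uniformly close to \<open>\<phi>\<close>, while by Fubini
  pairing \<open>w\<close> with \<open>\<rho> * \<phi>\<close> is the same as pairing \<open>\<rho> * w\<close>, which is bounded by \<open>g\<close>, with \<open>\<phi>\<close>.
  Since \<open>m \<ge> c\<close>, the bound passes to the pairing of \<open>w\<close> itself.
\<close>
lemma mollified_pairing_le:
  fixes w \<phi> :: "real^4 \<Rightarrow> real"
  assumes w: "w \<in> L2" and cont: "continuous_on UNIV \<phi>" and nn: "\<And>x. \<phi> x \<ge> 0"
    and supp: "\<And>x. x \<notin> cball 0 R \<Longrightarrow> \<phi> x = 0" and e: "\<epsilon> > 0"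
    and g[measurable]: "g \<in> borel_measurable borel"
    and bound: "\<And>\<delta> x. 0 < \<delta> \<Longrightarrow> \<delta> \<le> 1 \<Longrightarrow> ennreal \<bar>\<integral>y. w y * mollifier \<delta> (y - x) \<partial>lborel\<bar> \<le> g x"
    and c: "c = exp (- 2) * unit_ball_vol 4 / 16"
  shows "ennreal (c * (\<integral>y. w y * \<phi> y \<partial>lborel)) \<le> (\<integral>\<^sup>+x. g x * ennreal (\<phi> x) \<partial>lborel) + ennreal \<epsilon>"
proof -
  have c0: "c > 0" by (simp add: c)
  have [measurable]: "w \<in> borel_measurable borel" "\<phi> \<in> borel_measurable borel"
    using w cont by (auto simp: L2_measurable borel_measurable_continuous_onI)
  define I where "I = (\<integral>y. \<bar>w y\<bar> * indicator (cball 0 (R + 1)) y \<partial>lborel)"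
  have I: "I \<ge> 0" unfolding I_def by (intro Bochner_Integration.integral_nonneg) auto
  have \<phi>L: "\<phi> \<in> L2" using cont supp by (rule L2_continuous_compact_support[where T = "cball 0 R"]) auto
  have "bounded (\<phi> ` cball 0 R)"
    using cont by (intro compact_imp_bounded compact_continuous_image) (auto elim: continuous_on_subset)
  then have "\<exists>b. \<forall>x\<in>cball 0 R. \<bar>\<phi> x\<bar> \<le> b" by (auto simp: bounded_iff)
  then obtain B0 where B0: "\<And>x. x \<in> cball 0 R \<Longrightarrow> \<bar>\<phi> x\<bar> \<le> B0" by blast
  define B where "B = max B0 1"
  have B: "B > 0" "\<And>x. \<phi> x \<le> B" using B0 supp nn unfolding B_def
    by (auto simp: max_def) (smt (verit) abs_of_nonneg)+
  define \<eta> where "\<eta> = \<epsilon> / (2 * c * (I + 1))"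
  have \<eta>: "\<eta> > 0" using e c0 I by (simp add: \<eta>_def)
  have "uniformly_continuous_on (cball 0 (R + 1)) \<phi>"
    using cont by (intro compact_uniformly_continuous) (auto elim: continuous_on_subset)
  then obtain r0 where r0: "r0 > 0" and r0': "\<And>x y. x \<in> cball 0 (R + 1) \<Longrightarrow> y \<in> cball 0 (R + 1) \<Longrightarrow> dist y x < r0 \<Longrightarrow> dist (\<phi> y) (\<phi> x) < \<eta>"
    using \<eta> unfolding uniformly_continuous_on_def by metis
  define r where "r = min r0 1"
  have r: "r > 0" "r \<le> 1" using r0 by (auto simp: r_def)
  have uc: "\<bar>\<phi> x - \<phi> y\<bar> \<le> \<eta>" if "dist x y < r" for x y
  proof (cases "x \<in> cball 0 R \<or> y \<in> cball 0 R")
    case True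
    have "norm x \<le> norm y + dist x y" "norm y \<le> norm x + dist x y"
      by (metis dist_norm norm_triangle_sub) (metis dist_commute dist_norm norm_triangle_sub)
    then have "x \<in> cball 0 (R + 1)" "y \<in> cball 0 (R + 1)" using True that r by auto
    then show ?thesis using r0'[of y x] that by (simp add: r_def dist_real_def)
  qed (use supp \<eta> in auto)
  \<comment> \<open>So small that the mass of the mollifier outside radius \<open>r\<close>, times the bound on \<open>\<phi>\<close>, is at most \<open>\<eta> c\<close>.\<close>
  define \<delta> where "\<delta> = min 1 (\<eta> * c * r ^ 6 / (8 * B * unit_ball_vol 4))"
  have d: "\<delta> > 0" "\<delta> \<le> 1" using \<eta> c0 r B by (auto simp: \<delta>_def)
  define m where "m = mollifier_mass \<delta>"
  have m: "m \<ge> c" unfolding m_def c by (rule mollifier_mass_ge[OF d])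
  have d8: "8 * \<delta> / r ^ 6 * B * unit_ball_vol 4 \<le> \<eta> * m"
  proof -
    have "\<delta> * (8 * B * unit_ball_vol 4) \<le> \<eta> * c * r ^ 6"
      using B by (simp add: \<delta>_def pos_le_divide_eq[symmetric])
    then have "8 * \<delta> / r ^ 6 * B * unit_ball_vol 4 \<le> \<eta> * c" using r by (simp add: field_simps)
    also have "\<dots> \<le> \<eta> * m" using m \<eta> by simp
    finally show ?thesis .
  qed
  note [measurable] = mollifier_measurable[OF d(1)]
  define \<psi> where "\<psi> y = (\<integral>a. mollifier \<delta> (y - a) * \<phi> a \<partial>lborel)" for y
  have \<psi>int: "integrable lborel (\<lambda>a. mollifier \<delta> (y - a) * \<phi> a)" for y
    by (intro L2_mult_integrable mollifier_L2 d \<phi>L)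
  have \<psi>meas [measurable]: "\<psi> \<in> borel_measurable borel"
    unfolding \<psi>_def[abs_def] by measurable
  have close: "\<bar>\<psi> y - m * \<phi> y\<bar> \<le> 2 * \<eta> * m * indicator (cball 0 (R + 1)) y" for y
  proof (cases "y \<in> cball 0 (R + 1)")
    case False
    have "mollifier \<delta> (y - a) * \<phi> a = 0" for a
    proof (cases "a \<in> cball 0 R")
      case True
      have "norm y \<le> norm a + norm (y - a)" by (metis norm_triangle_sub)
      then have "norm (y - a) \<ge> 1" using True False by auto
      then show ?thesis by (simp add: mollifier_eq_0)
    qed (simp add: supp)
    then have "\<psi> y = 0" unfolding \<psi>_def by (simp only: Bochner_Integration.integral_zero)
    moreover have "\<phi> y = 0" using False r by (intro supp) auto
    ultimately show ?thesis using False by simp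
  next
    case True
    have i1: "integrable lborel (\<lambda>a. mollifier \<delta> (y - a) * \<eta>)"
      using mollifier_integrable[OF d(1)] by simp
    have i2: "integrable lborel (\<lambda>a. 8 * \<delta> / r ^ 6 * B * indicator (cball y 1) a)"
      using emeasure_lborel_cball_finite[of y 1] by (intro integrable_mult_right) auto
    have eq: "\<psi> y - m * \<phi> y = (\<integral>a. mollifier \<delta> (y - a) * \<phi> a - mollifier \<delta> (y - a) * \<phi> y \<partial>lborel)"
      unfolding \<psi>_def m_def mollifier_mass_eq[OF d(1), of y, symmetric]
      using \<psi>int mollifier_integrable[OF d(1)] by (subst Bochner_Integration.integral_diff) auto
    have "\<bar>\<psi> y - m * \<phi> y\<bar> \<le> (\<integral>a. \<bar>mollifier \<delta> (y - a) * \<phi> a - mollifier \<delta> (y - a) * \<phi> y\<bar> \<partial>lborel)"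
      unfolding eq by (rule integral_abs_bound)
    also have "\<dots> \<le> (\<integral>a. mollifier \<delta> (y - a) * \<eta> + 8 * \<delta> / r ^ 6 * B * indicator (cball y 1) a \<partial>lborel)"
    proof (rule integral_mono)
      show "integrable lborel (\<lambda>a. \<bar>mollifier \<delta> (y - a) * \<phi> a - mollifier \<delta> (y - a) * \<phi> y\<bar>)"
        using \<psi>int mollifier_integrable[OF d(1)] by auto
      show "integrable lborel (\<lambda>a. mollifier \<delta> (y - a) * \<eta> + 8 * \<delta> / r ^ 6 * B * indicator (cball y 1) a)"
        using i1 i2 by auto
      fix a
      have eq: "\<bar>mollifier \<delta> (y - a) * \<phi> a - mollifier \<delta> (y - a) * \<phi> y\<bar> = mollifier \<delta> (y - a) * \<bar>\<phi> a - \<phi> y\<bar>"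
        using mollifier_nonneg[OF d(1), of "y - a"] by (simp add: abs_mult flip: right_diff_distrib)
      show "\<bar>mollifier \<delta> (y - a) * \<phi> a - mollifier \<delta> (y - a) * \<phi> y\<bar> \<le> mollifier \<delta> (y - a) * \<eta> + 8 * \<delta> / r ^ 6 * B * indicator (cball y 1) a"
      proof (cases "norm (y - a) < r")
        case True
        then have "\<bar>\<phi> a - \<phi> y\<bar> \<le> \<eta>" using uc[of a y] by (simp add: dist_norm norm_minus_commute)
        then have "mollifier \<delta> (y - a) * \<bar>\<phi> a - \<phi> y\<bar> \<le> mollifier \<delta> (y - a) * \<eta>"
          using mollifier_nonneg[OF d(1)] by (intro mult_left_mono)
        moreover have "0 \<le> 8 * \<delta> / r ^ 6 * B * indicator (cball y 1) a" using d r B by simp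
        ultimately show ?thesis unfolding eq by linarith
      next
        case False
        have "\<bar>\<phi> a - \<phi> y\<bar> \<le> B" using B(2)[of a] B(2)[of y] nn[of a] nn[of y] by linarith
        then have "mollifier \<delta> (y - a) * \<bar>\<phi> a - \<phi> y\<bar> \<le> 8 * \<delta> / r ^ 6 * indicator (cball 0 1) (y - a) * B"
          using mollifier_le[OF d(1) r(1), of "y - a"] False d r by (intro mult_mono) auto
        also have "\<dots> = 8 * \<delta> / r ^ 6 * B * indicator (cball y 1) a" by (simp add: indicator_def dist_norm norm_minus_commute[of a y])
        also have "\<dots> \<le> mollifier \<delta> (y - a) * \<eta> + \<dots>" using mollifier_nonneg[OF d(1)] \<eta> by simp
        finally show ?thesis unfolding eq .
      qed
    qed
    also have "\<dots> = m * \<eta> + 8 * \<delta> / r ^ 6 * B * unit_ball_vol 4"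
      using i1 i2 by (subst Bochner_Integration.integral_add)
        (auto simp: mollifier_mass_eq[OF d(1)] m_def content_cball)
    also have "\<dots> \<le> 2 * \<eta> * m" using d8 by (simp add: algebra_simps)
    finally show ?thesis using True by simp
  qed
  have wint: "integrable lborel (\<lambda>y. \<bar>w y\<bar> * indicator (cball 0 (R + 1)) y)" by (rule L2_integrable_cball[OF w])
  have w\<phi>: "integrable lborel (\<lambda>y. w y * \<phi> y)" by (rule L2_mult_integrable[OF w \<phi>L])
  have dint: "integrable lborel (\<lambda>y. w y * (\<psi> y - m * \<phi> y))"
  proof (rule Bochner_Integration.integrable_bound)
    show "integrable lborel (\<lambda>y. 2 * \<eta> * m * (\<bar>w y\<bar> * indicator (cball 0 (R + 1)) y))" using wint by simp
    show "AE y in lborel. norm (w y * (\<psi> y - m * \<phi> y)) \<le> norm (2 * \<eta> * m * (\<bar>w y\<bar> * indicator (cball 0 (R + 1)) y))"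
    proof (intro AE_I2)
      fix y
      show "norm (w y * (\<psi> y - m * \<phi> y)) \<le> norm (2 * \<eta> * m * (\<bar>w y\<bar> * indicator (cball 0 (R + 1)) y))"
        using mult_left_mono[OF close[of y], of "\<bar>w y\<bar>"] \<eta> m c0 by (simp add: abs_mult mult_ac)
    qed
  qed measurable
  have w\<psi>: "integrable lborel (\<lambda>y. w y * \<psi> y)"
    using Bochner_Integration.integrable_add[OF dint integrable_mult_right[OF w\<phi>, of m]] by (simp add: algebra_simps)
  have diff: "\<bar>(\<integral>y. w y * \<psi> y \<partial>lborel) - m * (\<integral>y. w y * \<phi> y \<partial>lborel)\<bar> \<le> 2 * \<eta> * m * I"
  proof -
    have "(\<integral>y. w y * \<psi> y \<partial>lborel) - m * (\<integral>y. w y * \<phi> y \<partial>lborel) = (\<integral>y. w y * (\<psi> y - m * \<phi> y) \<partial>lborel)"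
      using w\<psi> w\<phi> by (simp add: right_diff_distrib mult.left_commute)
    also have "\<bar>\<dots>\<bar> \<le> (\<integral>y. \<bar>w y * (\<psi> y - m * \<phi> y)\<bar> \<partial>lborel)" by (rule integral_abs_bound)
    also have "\<dots> \<le> (\<integral>y. 2 * \<eta> * m * (\<bar>w y\<bar> * indicator (cball 0 (R + 1)) y) \<partial>lborel)"
    proof (rule integral_mono)
      fix y
      show "\<bar>w y * (\<psi> y - m * \<phi> y)\<bar> \<le> 2 * \<eta> * m * (\<bar>w y\<bar> * indicator (cball 0 (R + 1)) y)"
        using mult_left_mono[OF close[of y], of "\<bar>w y\<bar>"] by (simp add: abs_mult mult_ac)
    qed (use dint wint in auto)
    finally show ?thesis by (simp add: I_def)
  qed
  have fub: "(\<integral>y. w y * \<psi> y \<partial>lborel) = (\<integral>a. \<phi> a * (\<integral>y. w y * mollifier \<delta> (y - a) \<partial>lborel) \<partial>lborel)"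
  proof -
    have int: "integrable (lborel \<Otimes>\<^sub>M lborel) (\<lambda>(y, a). w y * (mollifier \<delta> (y - a) * \<phi> a))"
    proof (rule lborel_pair.Fubini_integrable)
      have "(\<lambda>y. \<integral>a. norm (w y * (mollifier \<delta> (y - a) * \<phi> a)) \<partial>lborel) = (\<lambda>y. \<bar>w y * \<psi> y\<bar>)"
      proof
        fix y
        have "\<psi> y \<ge> 0" unfolding \<psi>_def using nn mollifier_nonneg[OF d(1)] by (intro Bochner_Integration.integral_nonneg) auto
        then show "(\<integral>a. norm (w y * (mollifier \<delta> (y - a) * \<phi> a)) \<partial>lborel) = \<bar>w y * \<psi> y\<bar>"
          using nn mollifier_nonneg[OF d(1)] by (simp add: abs_mult \<psi>_def)
      qed
      then show "integrable lborel (\<lambda>y. \<integral>a. norm (case (y, a) of (y, a) \<Rightarrow> w y * (mollifier \<delta> (y - a) * \<phi> a)) \<partial>lborel)"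
        using w\<psi> by simp
      show "AE y in lborel. integrable lborel (\<lambda>a. case (y, a) of (y, a) \<Rightarrow> w y * (mollifier \<delta> (y - a) * \<phi> a))"
        using \<psi>int by simp
    qed measurable
    have "(\<integral>y. w y * \<psi> y \<partial>lborel) = (\<integral>y. \<integral>a. w y * (mollifier \<delta> (y - a) * \<phi> a) \<partial>lborel \<partial>lborel)"
      by (simp add: \<psi>_def)
    also have "\<dots> = (\<integral>a. \<integral>y. w y * (mollifier \<delta> (y - a) * \<phi> a) \<partial>lborel \<partial>lborel)"
      by (rule lborel_pair.Fubini_integral[OF int, symmetric])
    also have "\<dots> = (\<integral>a. \<phi> a * (\<integral>y. w y * mollifier \<delta> (y - a) \<partial>lborel) \<partial>lborel)"
      by (intro Bochner_Integration.integral_cong refl) (simp add: mult_ac flip: integral_mult_right_zero)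
    finally show ?thesis .
  qed
  define J where "J = (\<integral>y. w y * \<psi> y \<partial>lborel)"
  have "m * (\<integral>y. w y * \<phi> y \<partial>lborel) \<le> J + 2 * \<eta> * m * I" using diff unfolding J_def by linarith
  then have "c / m * (m * (\<integral>y. w y * \<phi> y \<partial>lborel)) \<le> c / m * (J + 2 * \<eta> * m * I)"
    using c0 m by (intro mult_left_mono) auto
  then have "c * (\<integral>y. w y * \<phi> y \<partial>lborel) \<le> c / m * J + 2 * \<eta> * c * I"
    using c0 m by (simp add: field_simps)
  also have "c / m * J \<le> \<bar>J\<bar>"
  proof -
    have "c / m * J \<le> c / m * \<bar>J\<bar>" using c0 m by (intro mult_left_mono) auto
    also have "\<dots> \<le> 1 * \<bar>J\<bar>" using c0 m by (intro mult_right_mono) auto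
    finally show ?thesis by simp
  qed
  also have "2 * \<eta> * c * I \<le> \<epsilon>"
  proof -
    have "\<eta> * (2 * c * (I + 1)) = \<epsilon>" using c0 I by (simp add: \<eta>_def)
    moreover have "0 \<le> \<eta> * (2 * c)" using \<eta> c0 by simp
    ultimately show ?thesis by (simp add: algebra_simps)
  qed
  finally have "ennreal (c * (\<integral>y. w y * \<phi> y \<partial>lborel)) \<le> ennreal (\<bar>J\<bar> + \<epsilon>)" by (simp add: ennreal_leI)
  also have "\<dots> = ennreal \<bar>J\<bar> + ennreal \<epsilon>" using e by simp
  also have "ennreal \<bar>J\<bar> \<le> (\<integral>\<^sup>+a. ennreal \<bar>\<phi> a * (\<integral>y. w y * mollifier \<delta> (y - a) \<partial>lborel)\<bar> \<partial>lborel)"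
    unfolding J_def fub by (rule abs_integral_le_nn_integral)
  also have "\<dots> \<le> (\<integral>\<^sup>+a. g a * ennreal (\<phi> a) \<partial>lborel)"
  proof (rule nn_integral_mono)
    fix a
    have "ennreal \<bar>\<phi> a * (\<integral>y. w y * mollifier \<delta> (y - a) \<partial>lborel)\<bar> = ennreal \<bar>\<integral>y. w y * mollifier \<delta> (y - a) \<partial>lborel\<bar> * ennreal (\<phi> a)"
      using nn by (simp add: abs_mult ennreal_mult mult.commute)
    also have "\<dots> \<le> g a * ennreal (\<phi> a)" by (intro mult_right_mono bound d) simp
    finally show "ennreal \<bar>\<phi> a * (\<integral>y. w y * mollifier \<delta> (y - a) \<partial>lborel)\<bar> \<le> g a * ennreal (\<phi> a)" .
  qed
  finally show ?thesis by simp
qed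

text \<open>
  The continuous functions \<open>max 0 (1 - n dist(x, C))\<close> decrease to the indicator of \<open>C\<close>; local
  integrability of \<open>g\<close> allows dominated convergence on both sides.
\<close>
lemma nn_integral_compact_le:
  fixes w :: "real^4 \<Rightarrow> real"
  assumes w: "w \<in> L2" and g[measurable]: "g \<in> borel_measurable borel"
    and gfin: "\<And>R. (\<integral>\<^sup>+x. g x * indicator (cball 0 R) x \<partial>lborel) < \<infinity>"
    and bound: "\<And>\<delta> x. 0 < \<delta> \<Longrightarrow> \<delta> \<le> 1 \<Longrightarrow> ennreal \<bar>\<integral>y. w y * mollifier \<delta> (y - x) \<partial>lborel\<bar> \<le> g x"
    and c: "c = exp (- 2) * unit_ball_vol 4 / 16"
    and C: "compact C" "C \<noteq> {}"
  shows "ennreal (c * (\<integral>y. w y * indicator C y \<partial>lborel)) \<le> (\<integral>\<^sup>+x. g x * indicator C x \<partial>lborel)"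
proof -
  have [measurable]: "w \<in> borel_measurable borel" using w by (simp add: L2_measurable)
  have [measurable]: "C \<in> sets borel" using C by (simp add: borel_compact)
  obtain R where R: "\<And>x. x \<in> C \<Longrightarrow> norm x \<le> R" using compact_imp_bounded[OF C(1)] unfolding bounded_iff by blast
  define \<phi> where "\<phi> n x = max 0 (1 - real (Suc n) * infdist x C)" for n x
  have \<phi>0: "0 \<le> \<phi> n x" and \<phi>1: "\<phi> n x \<le> 1" for n x by (auto simp: \<phi>_def infdist_nonneg)
  have \<phi>c: "continuous_on UNIV (\<phi> n)" for n
    unfolding \<phi>_def[abs_def] by (intro continuous_intros)
  have [measurable]: "\<phi> n \<in> borel_measurable borel" for n by (rule borel_measurable_continuous_onI[OF \<phi>c])
  have supp: "\<phi> n x = 0" if "x \<notin> cball 0 (R + 1)" for n x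
  proof -
    have "1 \<le> dist x y" if "y \<in> C" for y
      using R[OF that] \<open>x \<notin> cball 0 (R + 1)\<close> norm_triangle_sub[of x y] by (simp add: dist_norm)
    then have "1 \<le> infdist x C" using C(2) unfolding infdist_def by (auto intro: cINF_greatest)
    then have "1 \<le> real (Suc n) * infdist x C" using mult_mono[of 1 "real (Suc n)" 1 "infdist x C"] by simp
    then show ?thesis by (simp add: \<phi>_def)
  qed
  have lim: "(\<lambda>n. \<phi> n x) \<longlonglongrightarrow> indicator C x" for x
  proof (cases "x \<in> C")
    case False
    then have "infdist x C \<noteq> 0"
      using in_closed_iff_infdist_zero[OF compact_imp_closed[OF C(1)] C(2)] by simp
    then have pos: "infdist x C > 0" using infdist_nonneg[of x C] by linarith
    have "\<forall>\<^sub>F n in sequentially. 1 < real n * infdist x C"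
    proof -
      obtain N where N: "1 < real N * infdist x C" using pos reals_Archimedean3 by blast
      have "1 < real n * infdist x C" if "n \<ge> N" for n
        by (rule less_le_trans[OF N mult_right_mono]) (use that pos in auto)
      then show ?thesis by (auto simp: eventually_sequentially)
    qed
    then have "\<forall>\<^sub>F n in sequentially. \<phi> n x = 0"
    proof eventually_elim
      case (elim n)
      then show ?case using pos by (simp add: \<phi>_def distrib_right)
    qed
    then show ?thesis using False by (simp add: tendsto_eventually)
  qed (simp add: \<phi>_def)
  have limw: "(\<lambda>n. \<integral>y. w y * \<phi> n y \<partial>lborel) \<longlonglongrightarrow> (\<integral>y. w y * indicator C y \<partial>lborel)"
  proof (rule integral_dominated_convergence[where w = "\<lambda>y. \<bar>w y\<bar> * indicator (cball 0 (R + 1)) y"])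
    show "integrable lborel (\<lambda>y. \<bar>w y\<bar> * indicator (cball 0 (R + 1)) y)" by (rule L2_integrable_cball[OF w])
    show "AE y in lborel. (\<lambda>n. w y * \<phi> n y) \<longlonglongrightarrow> w y * indicator C y"
      by (intro AE_I2 tendsto_mult_left lim)
    show "AE y in lborel. norm (w y * \<phi> n y) \<le> \<bar>w y\<bar> * indicator (cball 0 (R + 1)) y" for n
      using \<phi>0 \<phi>1 supp by (intro AE_I2) (auto simp: abs_mult indicator_def intro!: mult_left_le)
  qed measurable
  have limg: "(\<lambda>n. \<integral>\<^sup>+x. g x * ennreal (\<phi> n x) \<partial>lborel) \<longlonglongrightarrow> (\<integral>\<^sup>+x. g x * indicator C x \<partial>lborel)"
  proof (rule nn_integral_dominated_convergence[where w = "\<lambda>x. g x * indicator (cball 0 (R + 1)) x"])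
    have "AE x in lborel. g x * indicator (cball 0 (R + 1)) x \<noteq> \<infinity>"
      using gfin[of "R + 1"] by (intro nn_integral_PInf_AE) auto
    then show "AE x in lborel. (\<lambda>n. g x * ennreal (\<phi> n x)) \<longlonglongrightarrow> g x * indicator C x"
    proof eventually_elim
      case (elim x)
      show ?case
      proof (cases "x \<in> cball 0 (R + 1)")
        case True
        then have "g x \<noteq> top" using elim by simp
        moreover have "(\<lambda>n. ennreal (\<phi> n x)) \<longlonglongrightarrow> ennreal (indicator C x)" by (intro tendsto_ennrealI lim)
        ultimately have "(\<lambda>n. g x * ennreal (\<phi> n x)) \<longlonglongrightarrow> g x * ennreal (indicator C x)"
          by (intro ennreal_tendsto_cmult) (auto simp: top.not_eq_extremum)
        then show ?thesis by (cases "x \<in> C") simp_all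
      next
        case False
        then have "x \<notin> C" using R by fastforce
        then show ?thesis using supp[OF False] by simp
      qed
    qed
    show "AE x in lborel. g x * ennreal (\<phi> n x) \<le> g x * indicator (cball 0 (R + 1)) x" for n
      using \<phi>1 supp by (intro AE_I2) (auto simp: indicator_def intro!: mult_left_le)
  qed (use gfin in measurable)
  show ?thesis
  proof (rule ennreal_le_epsilon)
    fix \<epsilon> :: real assume e: "0 < \<epsilon>"
    show "ennreal (c * (\<integral>y. w y * indicator C y \<partial>lborel)) \<le> (\<integral>\<^sup>+x. g x * indicator C x \<partial>lborel) + ennreal \<epsilon>"
    proof (rule LIMSEQ_le)
      show "(\<lambda>n. ennreal (c * (\<integral>y. w y * \<phi> n y \<partial>lborel))) \<longlonglongrightarrow> ennreal (c * (\<integral>y. w y * indicator C y \<partial>lborel))"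
        by (intro tendsto_ennrealI tendsto_mult_left limw)
      show "(\<lambda>n. (\<integral>\<^sup>+x. g x * ennreal (\<phi> n x) \<partial>lborel) + ennreal \<epsilon>) \<longlonglongrightarrow> (\<integral>\<^sup>+x. g x * indicator C x \<partial>lborel) + ennreal \<epsilon>"
        by (intro tendsto_add limg tendsto_const)
      show "\<exists>N. \<forall>n\<ge>N. ennreal (c * (\<integral>y. w y * \<phi> n y \<partial>lborel)) \<le> (\<integral>\<^sup>+x. g x * ennreal (\<phi> n x) \<partial>lborel) + ennreal \<epsilon>"
        using mollified_pairing_le[OF w \<phi>c \<phi>0 supp e g bound c] by blast
    qed
  qed
qed

text \<open>
  If the exceptional set had positive measure, inner regularity would give a compact subset of positive
  measure, on which integrating the strict reverse inequality contradicts the preceding lemma.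
\<close>
lemma AE_le_of_mollified_bound_one_sided:
  fixes w :: "real^4 \<Rightarrow> real"
  assumes w: "w \<in> L2" and g[measurable]: "g \<in> borel_measurable borel"
    and gfin: "\<And>R. (\<integral>\<^sup>+x. g x * indicator (cball 0 R) x \<partial>lborel) < \<infinity>"
    and bound: "\<And>\<delta> x. 0 < \<delta> \<Longrightarrow> \<delta> \<le> 1 \<Longrightarrow> ennreal \<bar>\<integral>y. w y * mollifier \<delta> (y - x) \<partial>lborel\<bar> \<le> g x"
    and c: "c = exp (- 2) * unit_ball_vol 4 / 16"
  shows "AE x in lborel. ennreal (c * w x) \<le> g x"
proof -
  have c0: "c > 0" by (simp add: c)
  have [measurable]: "w \<in> borel_measurable borel" using w by (simp add: L2_measurable)
  have wloc: "integrable lborel (\<lambda>y. w y * indicator C y)" if "compact C" for C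
  proof -
    have [measurable]: "C \<in> sets borel" using that by (simp add: borel_compact)
    have "bounded C" using that by (rule compact_imp_bounded)
    then have "\<exists>R. \<forall>x\<in>C. norm x \<le> R" by (simp add: bounded_iff)
    then obtain R where "\<forall>x\<in>C. norm x \<le> R" ..
    then have R: "C \<subseteq> cball 0 R" by auto
    show ?thesis
    proof (rule Bochner_Integration.integrable_bound[OF L2_integrable_cball[OF w, of R]])
      show "AE y in lborel. norm (w y * indicator C y) \<le> norm (\<bar>w y\<bar> * indicator (cball 0 R) y)"
        using R by (intro AE_I2) (auto simp: abs_mult indicator_def)
    qed measurable
  qed
  define A where "A R = {x. g x < ennreal (c * w x)} \<inter> ball 0 (real R)" for R
  have A [measurable]: "A R \<in> sets borel" for R unfolding A_def by measurable
  have null: "emeasure lborel (A R) = 0" for R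
  proof (rule ccontr)
    assume pos: "emeasure lborel (A R) \<noteq> 0"
    \<comment> \<open>Restriction to a ball makes the measure finite, as inner regularity requires.\<close>
    define \<mu> where "\<mu> = density lborel (indicator (ball (0::real^4) (real R)))"
    have \<mu>: "emeasure \<mu> B = emeasure lborel (B \<inter> ball 0 (real R))" if "B \<in> sets borel" for B
      using that unfolding \<mu>_def by (subst emeasure_density) (auto simp: nn_integral_indicator[symmetric] indicator_inter_arith mult.commute intro!: nn_integral_cong split: split_indicator)
    have "emeasure \<mu> (A R) = (SUP C \<in> {C. C \<subseteq> A R \<and> compact C}. emeasure \<mu> C)"
    proof (rule inner_regular)
      show "sets \<mu> = sets borel" by (simp add: \<mu>_def)
      have "emeasure \<mu> UNIV = emeasure lborel (ball (0::real^4) (real R))" using \<mu>[of UNIV] by simp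
      then show "emeasure \<mu> (space \<mu>) \<noteq> \<infinity>"
        using emeasure_lborel_ball_finite[of "0::real^4" "real R"] by (simp add: \<mu>_def)
    qed measurable
    moreover have "emeasure \<mu> (A R) > 0"
      using pos \<mu>[OF A, of R] by (simp add: A_def Int_assoc zero_less_iff_neq_zero)
    ultimately obtain C where C: "C \<subseteq> A R" "compact C" "emeasure \<mu> C > 0"
      by (auto simp: less_SUP_iff)
    have [measurable]: "C \<in> sets borel" using C by (simp add: borel_compact)
    have Cne: "C \<noteq> {}" and CR: "C \<subseteq> ball 0 (real R)" using C by (auto simp: A_def)
    have Cpos: "emeasure lborel C > 0" using C(3) \<mu>[of C] CR by (simp add: Int_absorb2)
    have lt: "g x < ennreal (c * w x)" if "x \<in> C" for x using that C(1) by (auto simp: A_def)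
    have wpos: "w x > 0" if "x \<in> C" for x
      using lt[OF that] c0 by (metis ennreal_eq_0_iff linorder_not_less mult_le_0_iff not_less_zero order.strict_iff_not)
    have int: "(\<integral>\<^sup>+x. ennreal (c * w x) * indicator C x \<partial>lborel) = ennreal (c * (\<integral>y. w y * indicator C y \<partial>lborel))"
    proof -
      have "(\<integral>\<^sup>+x. ennreal (c * w x) * indicator C x \<partial>lborel) = (\<integral>\<^sup>+x. ennreal (c * (w x * indicator C x)) \<partial>lborel)"
        by (intro nn_integral_cong) (auto simp: indicator_def)
      also have "\<dots> = ennreal (\<integral>x. c * (w x * indicator C x) \<partial>lborel)"
        using wloc[OF C(2)] wpos c0 by (intro nn_integral_eq_integral) (auto simp: indicator_def less_imp_le)
      finally show ?thesis by simp
    qed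
    have le: "(\<integral>\<^sup>+x. ennreal (c * w x) * indicator C x \<partial>lborel) \<le> (\<integral>\<^sup>+x. g x * indicator C x \<partial>lborel)"
      unfolding int by (rule nn_integral_compact_le[OF w g gfin bound c C(2) Cne])
    have "(\<integral>\<^sup>+x. g x * indicator C x \<partial>lborel) < (\<integral>\<^sup>+x. ennreal (c * w x) * indicator C x \<partial>lborel)"
    proof (rule nn_integral_less)
      show "(\<integral>\<^sup>+x. g x * indicator C x \<partial>lborel) \<noteq> \<infinity>"
      proof -
        have "(\<integral>\<^sup>+x. g x * indicator C x \<partial>lborel) \<le> (\<integral>\<^sup>+x. g x * indicator (cball 0 (real R)) x \<partial>lborel)"
          using CR by (intro nn_integral_mono) (auto simp: indicator_def)
        then show ?thesis using gfin[of "real R"] by auto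
      qed
      show "AE x in lborel. g x * indicator C x \<le> ennreal (c * w x) * indicator C x"
        using lt by (intro AE_I2) (auto simp: indicator_def less_imp_le)
      show "\<not> (AE x in lborel. ennreal (c * w x) * indicator C x \<le> g x * indicator C x)"
      proof
        assume "AE x in lborel. ennreal (c * w x) * indicator C x \<le> g x * indicator C x"
        then have "AE x in lborel. x \<notin> C"
          by eventually_elim (use lt in \<open>force simp: indicator_def not_le split: if_splits\<close>)
        then have "emeasure lborel C = 0" by (subst (asm) AE_iff_measurable[of C]) auto
        then show False using Cpos by simp
      qed
    qed measurable
    with le show False by simp
  qed
  have "AE x in lborel. x \<notin> A R" for R
    using null[of R] by (subst AE_iff_measurable[of "A R"]) auto
  then have "AE x in lborel. \<forall>R. x \<notin> A R" by (simp add: AE_all_countable)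
  then show ?thesis
  proof eventually_elim
    case (elim x)
    obtain R where "norm x < real R" using reals_Archimedean2 by blast
    then show ?case using elim[rule_format, of R] by (simp add: A_def not_less)
  qed
qed

lemma AE_le_of_mollified_bound:
  fixes w :: "real^4 \<Rightarrow> real"
  assumes w: "w \<in> L2" and g: "g \<in> borel_measurable borel"
    and gfin: "\<And>R. (\<integral>\<^sup>+x. g x * indicator (cball 0 R) x \<partial>lborel) < \<infinity>"
    and bound: "\<And>\<delta> x. 0 < \<delta> \<Longrightarrow> \<delta> \<le> 1 \<Longrightarrow> ennreal \<bar>\<integral>y. w y * mollifier \<delta> (y - x) \<partial>lborel\<bar> \<le> g x"
    and c: "c = exp (- 2) * unit_ball_vol 4 / 16"
  shows "AE x in lborel. ennreal (c * \<bar>w x\<bar>) \<le> g x"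
proof -
  have "(\<lambda>x. - w x) \<in> L2" using L2_cmult[OF w, of "-1"] by simp
  from AE_le_of_mollified_bound_one_sided[OF this g gfin _ c] have "AE x in lborel. ennreal (c * - w x) \<le> g x"
    using bound by simp
  moreover have "AE x in lborel. ennreal (c * w x) \<le> g x"
    by (rule AE_le_of_mollified_bound_one_sided[OF w g gfin bound c])
  ultimately show ?thesis
    by eventually_elim (auto simp: abs_if)
qed

section \<open>Exponential integrability of a single Sobolev function\<close>

lemma ennreal_le_add: "a \<le> b + c \<Longrightarrow> 0 \<le> b \<Longrightarrow> 0 \<le> c \<Longrightarrow> ennreal a \<le> ennreal b + ennreal c"
  by (metis ennreal_leI ennreal_plus)

lemma L2_abs: "u \<in> L2 \<Longrightarrow> (\<lambda>x. \<bar>u x\<bar>) \<in> L2"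
  by (auto simp: L2_def)

lemma L2_nn_integral_finite: "u \<in> L2 \<Longrightarrow> (\<integral>\<^sup>+x. ennreal ((u x)\<^sup>2) \<partial>lborel) < \<infinity>"
  unfolding L2_def by (auto simp: integrable_iff_bounded)

text \<open>
  From \<open>f \<le> 1 + f\<^sup>2\<close> the potential is a bounded function plus the integrable potential of \<open>f\<^sup>2\<close>.
\<close>
lemma potential_locally_integrable:
  assumes f: "f \<in> L2" and nn: "\<And>y. f y \<ge> 0"
  shows "(\<integral>\<^sup>+x. potential f x * indicator (cball 0 R) x \<partial>lborel) < \<infinity>"
proof -
  have [measurable]: "f \<in> borel_measurable borel" using f by (rule L2_measurable)
  have le: "potential f x \<le> ennreal (2 * unit_ball_vol 4) + potential (\<lambda>y. (f y)\<^sup>2) x" for x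
  proof -
    have "potential f x \<le> (\<integral>\<^sup>+y. ennreal (newton_kernel (y - x) * 1) + ennreal (newton_kernel (y - x) * (f y)\<^sup>2) \<partial>lborel)"
      unfolding potential_def
    proof (rule nn_integral_mono)
      fix y
      have "f y \<le> 1 + (f y)\<^sup>2" by (smt (verit) self_le_power zero_le_power2 pos2)
      then have "newton_kernel (y - x) * f y \<le> newton_kernel (y - x) * 1 + newton_kernel (y - x) * (f y)\<^sup>2"
        using mult_left_mono[of "f y" "1 + (f y)\<^sup>2" "newton_kernel (y - x)"] newton_kernel_nonneg by (simp add: distrib_left)
      then show "ennreal (newton_kernel (y - x) * f y) \<le> ennreal (newton_kernel (y - x) * 1) + ennreal (newton_kernel (y - x) * (f y)\<^sup>2)"
        using newton_kernel_nonneg by (intro ennreal_le_add) auto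
    qed
    also have "\<dots> = potential (\<lambda>_. 1) x + potential (\<lambda>y. (f y)\<^sup>2) x"
      unfolding potential_def by (intro nn_integral_add) measurable
    also have "\<dots> \<le> ennreal (2 * unit_ball_vol 4 * 1) + potential (\<lambda>y. (f y)\<^sup>2) x"
      by (intro add_right_mono potential_le_const) auto
    finally show ?thesis by simp
  qed
  have "(\<integral>\<^sup>+x. potential f x * indicator (cball 0 R) x \<partial>lborel)
     \<le> (\<integral>\<^sup>+x. ennreal (2 * unit_ball_vol 4) * indicator (cball 0 R) x + potential (\<lambda>y. (f y)\<^sup>2) x \<partial>lborel)"
    using le by (intro nn_integral_mono) (auto simp: indicator_def)
  also have "\<dots> = ennreal (2 * unit_ball_vol 4) * emeasure lborel (cball (0::real^4) R) + (\<integral>\<^sup>+x. potential (\<lambda>y. (f y)\<^sup>2) x \<partial>lborel)"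
    by (subst nn_integral_add) (auto simp: nn_integral_cmult_indicator)
  also have "\<dots> \<le> ennreal (2 * unit_ball_vol 4) * emeasure lborel (cball (0::real^4) R)
      + ennreal (2 * unit_ball_vol 4) * (\<integral>\<^sup>+y. ennreal ((f y)\<^sup>2) \<partial>lborel)"
    by (intro add_left_mono nn_integral_potential) auto
  also have "\<dots> < \<infinity>"
    using L2_nn_integral_finite[OF f] emeasure_lborel_cball_finite[of "0::real^4" R]
    by (simp add: ennreal_mult_less_top)
  finally show ?thesis .
qed

text \<open>
  The substitute for the representation of \<open>u\<close> by its Laplacian. The additional \<open>|u|\<close> in the density
  pays for cutting the kernel off.
\<close>
lemma sobolev_pointwise_bound:
  "\<exists>C>0. \<forall>u\<in>sobolev_H 2. AE x in lborel. ennreal \<bar>u x\<bar> \<le> ennreal C * potential (\<lambda>y. \<bar>u y\<bar> + \<bar>weak_laplacian u y\<bar>) x"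
proof -
  obtain C0 where C0: "C0 \<ge> 0" and bd: "\<And>u \<delta> a. u \<in> sobolev_H 2 \<Longrightarrow> \<delta> > 0 \<Longrightarrow>
     ennreal \<bar>\<integral>y. u y * (8 * \<delta> * cutoff 1 3 \<delta> ((norm (y - a))\<^sup>2)) \<partial>lborel\<bar> \<le>
     ennreal C0 * (\<integral>\<^sup>+y. ennreal (newton_kernel (y - a) * (\<bar>u y\<bar> + \<bar>weak_laplacian u y\<bar>)) \<partial>lborel)"
    using mollification_bound by blast
  define c :: real where "c = exp (- 2) * unit_ball_vol 4 / 16"
  have c: "c > 0" by (simp add: c_def)
  show ?thesis
  proof (intro exI[of _ "(C0 + 1) / c"] conjI ballI)
    show "(C0 + 1) / c > 0" using C0 c by simp
    fix u :: "real^4 \<Rightarrow> real" assume u: "u \<in> sobolev_H 2"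
    let ?f = "\<lambda>y. \<bar>u y\<bar> + \<bar>weak_laplacian u y\<bar>"
    have uL: "u \<in> L2" using u by (simp add: sobolev_H_def)
    have fL: "?f \<in> L2" by (intro L2_add L2_abs uL weak_laplacian_L2 u)
    have [measurable]: "?f \<in> borel_measurable borel" by (rule L2_measurable[OF fL])
    have "AE x in lborel. ennreal (c * \<bar>u x\<bar>) \<le> ennreal (C0 + 1) * potential ?f x"
    proof (rule AE_le_of_mollified_bound[OF uL _ _ _ c_def])
      show "(\<lambda>x. ennreal (C0 + 1) * potential ?f x) \<in> borel_measurable borel" by measurable
      show "(\<integral>\<^sup>+x. ennreal (C0 + 1) * potential ?f x * indicator (cball 0 R) x \<partial>lborel) < \<infinity>" for R
        using potential_locally_integrable[OF fL, of R]
        by (simp add: mult.assoc nn_integral_cmult ennreal_mult_less_top)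
      fix \<delta> :: real and x assume d: "0 < \<delta>"
      have "ennreal \<bar>\<integral>y. u y * mollifier \<delta> (y - x) \<partial>lborel\<bar> \<le> ennreal C0 * potential ?f x"
        using bd[OF u d, of x] by (simp add: mollifier_def potential_def)
      also have "\<dots> \<le> ennreal (C0 + 1) * potential ?f x"
        by (intro mult_right_mono ennreal_leI) auto
      finally show "ennreal \<bar>\<integral>y. u y * mollifier \<delta> (y - x) \<partial>lborel\<bar> \<le> ennreal (C0 + 1) * potential ?f x" .
    qed
    then show "AE x in lborel. ennreal \<bar>u x\<bar> \<le> ennreal ((C0 + 1) / c) * potential ?f x"
    proof eventually_elim
      case (elim x)
      have "ennreal \<bar>u x\<bar> = ennreal (1 / c) * ennreal (c * \<bar>u x\<bar>)" using c by (simp add: ennreal_mult[symmetric])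
      also have "\<dots> \<le> ennreal (1 / c) * (ennreal (C0 + 1) * potential ?f x)" by (intro mult_left_mono elim) simp
      also have "\<dots> = ennreal ((C0 + 1) / c) * potential ?f x"
      proof -
        have "ennreal (1 / c) * ennreal (C0 + 1) = ennreal (1 / c * (C0 + 1))"
          using c C0 by (intro ennreal_mult[symmetric]) auto
        then show ?thesis by (simp only: mult.assoc[symmetric]) simp
      qed
      finally show ?case .
    qed
  qed
qed

text \<open>
  The mollifiers are themselves multiples of test functions, so all mollifications of \<open>w\<close> vanish.
\<close>
lemma fundamental_lemma:
  fixes w :: "real^4 \<Rightarrow> real"
  assumes w: "w \<in> L2" and zero: "\<And>\<phi>. test_function \<phi> \<Longrightarrow> (\<integral>x. w x * \<phi> x \<partial>lborel) = 0"
  shows "AE x in lborel. w x = 0"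
proof -
  define c :: real where "c = exp (- 2) * unit_ball_vol 4 / 16"
  have c: "c > 0" by (simp add: c_def)
  have "AE x in lborel. ennreal (c * \<bar>w x\<bar>) \<le> 0"
  proof (rule AE_le_of_mollified_bound[OF w _ _ _ c_def])
    fix \<delta> :: real and x assume d: "0 < \<delta>"
    have "(\<integral>y. w y * mollifier \<delta> (y - x) \<partial>lborel) = 8 * \<delta> * (\<integral>y. w y * cutoff 1 3 \<delta> ((norm (y - x))\<^sup>2) \<partial>lborel)"
      unfolding mollifier_def by (simp add: mult.left_commute flip: integral_mult_right_zero)
    then show "ennreal \<bar>\<integral>y. w y * mollifier \<delta> (y - x) \<partial>lborel\<bar> \<le> 0"
      using zero[OF test_function_cutoff[OF d]] by simp
  qed auto
  then show ?thesis
  proof eventually_elim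
    case (elim x)
    then have "c * \<bar>w x\<bar> \<le> 0" by (simp add: ennreal_eq_0_iff)
    then show ?case using c by (simp add: mult_le_0_iff)
  qed
qed

lemma L2_tail_small:
  fixes f :: "'a::euclidean_space \<Rightarrow> real"
  assumes f: "f \<in> L2" and nn: "\<And>y. f y \<ge> 0" and m: "m > 0"
  obtains N :: real where "N > 0" "(\<integral>\<^sup>+y. ennreal ((max 0 (f y - N))\<^sup>2) \<partial>lborel) \<le> ennreal m"
proof -
  have [measurable]: "f \<in> borel_measurable borel" using f by (rule L2_measurable)
  have int: "integrable lborel (\<lambda>y. (f y)\<^sup>2)" using f by (simp add: L2_def)
  have le: "(max 0 (f y - real (Suc n)))\<^sup>2 \<le> (f y)\<^sup>2" for y n
    using nn[of y] by (intro power_mono) auto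
  have "(\<lambda>n. \<integral>y. (max 0 (f y - real (Suc n)))\<^sup>2 \<partial>lborel) \<longlonglongrightarrow> (\<integral>y. 0 \<partial>(lborel :: 'a measure))"
  proof (rule integral_dominated_convergence[where w = "\<lambda>y. (f y)\<^sup>2"])
    show "integrable lborel (\<lambda>y. (f y)\<^sup>2)" by (rule int)
    show "AE y in lborel. (\<lambda>n. (max 0 (f y - real (Suc n)))\<^sup>2) \<longlonglongrightarrow> 0"
    proof (intro AE_I2 tendsto_eventually)
      fix y
      obtain N where "f y < real N" using reals_Archimedean2 by blast
      then show "\<forall>\<^sub>F n in sequentially. (max 0 (f y - real (Suc n)))\<^sup>2 = 0"
        by (intro eventually_sequentiallyI[of N]) (auto simp: max_def)
    qed
    show "AE y in lborel. norm ((max 0 (f y - real (Suc n)))\<^sup>2) \<le> (f y)\<^sup>2" for n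
      using le by (intro AE_I2) simp
  qed measurable
  then have "(\<lambda>n. \<integral>y. (max 0 (f y - real (Suc n)))\<^sup>2 \<partial>lborel) \<longlonglongrightarrow> 0" by simp
  from order_tendstoD(2)[OF this m] obtain n where n: "(\<integral>y. (max 0 (f y - real (Suc n)))\<^sup>2 \<partial>lborel) < m"
    by (auto simp: eventually_sequentially)
  have "integrable lborel (\<lambda>y. (max 0 (f y - real (Suc n)))\<^sup>2)"
    by (rule Bochner_Integration.integrable_bound[OF int]) (use le in auto)
  then have "(\<integral>\<^sup>+y. ennreal ((max 0 (f y - real (Suc n)))\<^sup>2) \<partial>lborel) = ennreal (\<integral>y. (max 0 (f y - real (Suc n)))\<^sup>2 \<partial>lborel)"
    by (intro nn_integral_eq_integral) auto
  also have "\<dots> \<le> ennreal m" using n by (intro ennreal_leI) simp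
  finally show ?thesis using that[of "real (Suc n)"] by simp
qed

definition exp_rem :: "real \<Rightarrow> real" where
  "exp_rem t = exp t - 1 - t"

lemma exp_rem_nonneg: "exp_rem t \<ge> 0"
  unfolding exp_rem_def using exp_ge_add_one_self[of t] by linarith

text \<open>
  Where \<open>|u| \<le> L\<close>, the integrand is bounded by a multiple of \<open>u\<^sup>2\<close>. Where \<open>|u| > L\<close>, the bounded
  part of the potential accounts for at most half of \<open>|u|\<close>, so \<open>u\<close> is controlled by the potential of
  the small tail, and the exponential estimate applies; the constants that it leaves over are
  absorbed into \<open>u\<^sup>2 / L\<^sup>2 \<ge> 1\<close>.
\<close>
lemma exp_rem_integrable:
  fixes u :: "real^4 \<Rightarrow> real"
  assumes u: "u \<in> sobolev_H 2" and k: "k > 0"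
  shows "(\<integral>\<^sup>+x. ennreal (exp_rem (k * (u x)\<^sup>2)) \<partial>lborel) < \<infinity>"
proof -
  let ?V = "unit_ball_vol 4 :: real"
  have V: "?V > 0" by simp
  let ?f = "\<lambda>y. \<bar>u y\<bar> + \<bar>weak_laplacian u y\<bar>"
  have uL: "u \<in> L2" using u by (simp add: sobolev_H_def)
  have fL: "?f \<in> L2" by (intro L2_add L2_abs uL weak_laplacian_L2 u)
  have [measurable]: "?f \<in> borel_measurable borel" "u \<in> borel_measurable borel"
    by (auto intro!: L2_measurable uL fL)
  obtain C where C: "C > 0" and ub: "AE x in lborel. ennreal \<bar>u x\<bar> \<le> ennreal C * potential ?f x"
    using sobolev_pointwise_bound u by blast
  define b where "b = 4 * k * C\<^sup>2"
  have b: "b > 0" using k C by (simp add: b_def)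
  define m where "m = 1 / (4 * b * ?V)"
  have m: "m > 0" using b V by (simp add: m_def)
  obtain N where N: "N > 0" and fN: "(\<integral>\<^sup>+y. ennreal ((max 0 (?f y - N))\<^sup>2) \<partial>lborel) \<le> ennreal m"
    using L2_tail_small[OF fL _ m] by auto
  define f2 where "f2 y = max 0 (?f y - N)" for y
  have f2nn: "f2 y \<ge> 0" for y by (simp add: f2_def)
  have [measurable]: "f2 \<in> borel_measurable borel" unfolding f2_def by measurable
  have f2m: "(\<integral>\<^sup>+y. ennreal ((f2 y)\<^sup>2) \<partial>lborel) \<le> ennreal m" using fN by (simp add: f2_def)
  let ?Q = "potential (\<lambda>y. (f2 y)\<^sup>2)"
  have Qint: "(\<integral>\<^sup>+x. ?Q x \<partial>lborel) < \<infinity>"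
  proof -
    have "(\<integral>\<^sup>+x. ?Q x \<partial>lborel) \<le> ennreal (2 * ?V) * (\<integral>\<^sup>+y. ennreal ((f2 y)\<^sup>2) \<partial>lborel)"
      by (rule nn_integral_potential) auto
    also have "\<dots> \<le> ennreal (2 * ?V) * ennreal m" by (intro mult_left_mono f2m) simp
    finally show ?thesis by (auto simp: ennreal_mult_less_top intro: le_less_trans)
  qed
  have Qfin: "AE x in lborel. ?Q x \<noteq> \<infinity>" using Qint by (intro nn_integral_PInf_AE) auto
  have pot: "potential ?f x \<le> ennreal (2 * ?V * N) + potential f2 x" for x
  proof -
    have "potential ?f x \<le> (\<integral>\<^sup>+y. ennreal (newton_kernel (y - x) * N) + ennreal (newton_kernel (y - x) * f2 y) \<partial>lborel)"
      unfolding potential_def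
    proof (rule nn_integral_mono)
      fix y
      have "?f y \<le> N + f2 y" by (simp add: f2_def)
      then have "newton_kernel (y - x) * ?f y \<le> newton_kernel (y - x) * N + newton_kernel (y - x) * f2 y"
        using mult_left_mono[of "?f y" "N + f2 y" "newton_kernel (y - x)"] newton_kernel_nonneg by (simp add: distrib_left)
      then show "ennreal (newton_kernel (y - x) * ?f y) \<le> ennreal (newton_kernel (y - x) * N) + ennreal (newton_kernel (y - x) * f2 y)"
        using newton_kernel_nonneg[of "y - x"] N f2nn[of y] by (intro ennreal_le_add) auto
    qed
    also have "\<dots> = potential (\<lambda>_. N) x + potential f2 x"
      unfolding potential_def by (intro nn_integral_add) measurable
    also have "\<dots> \<le> ennreal (2 * ?V * N) + potential f2 x"
      using N by (intro add_right_mono potential_le_const) auto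
    finally show ?thesis .
  qed
  \<comment> \<open>Twice the contribution of the bounded part \<open>min f N\<close> to the pointwise bound on \<open>|u|\<close>.\<close>
  define L where "L = 4 * ?V * N * C"
  have L: "L > 0" using V N C by (simp add: L_def)
  define A where "A = k * exp (k * L\<^sup>2) + 4 / L\<^sup>2"
  have A: "A \<ge> 0" using k by (simp add: A_def)
  have main: "AE x in lborel. ennreal (exp_rem (k * (u x)\<^sup>2)) \<le> ennreal A * ennreal ((u x)\<^sup>2) + ennreal (2 / m) * ?Q x"
    using ub Qfin
  proof eventually_elim
    case (elim x)
    obtain q where q: "q \<ge> 0" "?Q x = ennreal q" using elim(2) by (cases "?Q x") auto
    obtain h where h: "h \<ge> 0" "potential f2 x = ennreal h" "exp (b * h\<^sup>2) \<le> 2 * (2 + q / m)"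
      using exp_potential_le[OF _ f2nn b m_def f2m q(2,1)] by auto
    have "ennreal \<bar>u x\<bar> \<le> ennreal C * (ennreal (2 * ?V * N) + ennreal h)"
      using order_trans[OF elim(1) mult_left_mono[OF pot[of x], of "ennreal C"]] unfolding h(2) by simp
    also have "\<dots> = ennreal (C * (2 * ?V * N + h))"
    proof -
      have X: "0 \<le> 2 * ?V * N" using N by simp
      show ?thesis
        by (simp only: ennreal_mult[OF less_imp_le[OF C] add_nonneg_nonneg[OF X h(1)]] ennreal_plus[OF X h(1)])
    qed
    finally have "\<bar>u x\<bar> \<le> C * (2 * ?V * N + h)" using C N V h(1) by (simp add: ennreal_le_iff)
    then have ux: "\<bar>u x\<bar> \<le> L / 2 + C * h" by (simp add: L_def algebra_simps)
    define t where "t = k * (u x)\<^sup>2"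
    have t: "t \<ge> 0" using k by (simp add: t_def)
    have "exp_rem t \<le> A * (u x)\<^sup>2 + (2 / m) * q"
    proof (cases "\<bar>u x\<bar> \<le> L")
      case True
      have tL: "t \<le> k * L\<^sup>2" unfolding t_def using True k L
        by (intro mult_left_mono) (auto simp: abs_le_square_iff[symmetric])
      have "(1 - t) * exp t \<le> exp (- t) * exp t" using exp_ge_add_one_self[of "- t"] by (intro mult_right_mono) auto
      then have "exp t - 1 \<le> t * exp t" by (simp add: exp_minus algebra_simps)
      also have "\<dots> \<le> t * exp (k * L\<^sup>2)" using t tL by (intro mult_left_mono) auto
      also have "\<dots> = (k * exp (k * L\<^sup>2)) * (u x)\<^sup>2" by (simp add: t_def)
      also have "\<dots> \<le> A * (u x)\<^sup>2" by (intro mult_right_mono) (auto simp: A_def)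
      finally have "exp_rem t \<le> A * (u x)\<^sup>2" using t by (simp add: exp_rem_def)
      moreover have "0 \<le> (2 / m) * q" using m q by simp
      ultimately show ?thesis by linarith
    next
      case False
      then have "\<bar>u x\<bar> \<le> 2 * C * h" using ux by linarith
      then have "(u x)\<^sup>2 \<le> (2 * C * h)\<^sup>2" using power_mono[of "\<bar>u x\<bar>" "2 * C * h" 2] by simp
      then have "t \<le> k * (2 * C * h)\<^sup>2" unfolding t_def using k by (intro mult_left_mono) auto
      also have "\<dots> = b * h\<^sup>2" by (simp add: b_def power_mult_distrib)
      finally have "exp t \<le> 2 * (2 + q / m)" using h(3) by (meson exp_le_cancel_iff order_trans)
      moreover have "4 \<le> 4 / L\<^sup>2 * (u x)\<^sup>2"
        using False L power_mono[of L "\<bar>u x\<bar>" 2] by (simp add: field_simps)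
      moreover have "4 / L\<^sup>2 * (u x)\<^sup>2 \<le> A * (u x)\<^sup>2"
        using k by (intro mult_right_mono) (auto simp: A_def)
      ultimately show ?thesis using t by (simp add: exp_rem_def)
    qed
    then show ?case using A m q unfolding t_def
      by (simp add: q ennreal_mult[symmetric] flip: ennreal_plus)
  qed
  have "(\<integral>\<^sup>+x. ennreal (exp_rem (k * (u x)\<^sup>2)) \<partial>lborel) \<le> (\<integral>\<^sup>+x. ennreal A * ennreal ((u x)\<^sup>2) + ennreal (2 / m) * ?Q x \<partial>lborel)"
    by (rule nn_integral_mono_AE[OF main])
  also have "\<dots> = ennreal A * (\<integral>\<^sup>+x. ennreal ((u x)\<^sup>2) \<partial>lborel) + ennreal (2 / m) * (\<integral>\<^sup>+x. ?Q x \<partial>lborel)"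
    by (subst nn_integral_add) (auto simp: nn_integral_cmult)
  also have "\<dots> < \<infinity>" using Qint L2_nn_integral_finite[OF uL] by (simp add: ennreal_mult_less_top)
  finally show ?thesis .
qed

section \<open>Rescaling and the Sobolev space\<close>

lemma C_k_scale: "C_k k f \<Longrightarrow> C_k k (\<lambda>x. f (r *\<^sub>R x))"
proof (induction k arbitrary: f)
  case 0
  then show ?case by (auto intro!: continuous_on_compose2[of UNIV f] continuous_intros)
next
  case (Suc k)
  obtain D where D: "\<And>x. (f has_derivative D x) (at x)" "\<And>b. b \<in> Basis \<Longrightarrow> C_k k (\<lambda>x. D x b)"
    using C_k_Suc_has_derivative[OF Suc.prems] by blast
  show ?case
  proof (rule C_k_SucI)
    show "((\<lambda>x. f (r *\<^sub>R x)) has_derivative (\<lambda>y. r * D (r *\<^sub>R x) y)) (at x)" for x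
    proof -
      have "((\<lambda>x. r *\<^sub>R x) has_derivative (\<lambda>y. r *\<^sub>R y)) (at x)" by (auto intro!: derivative_eq_intros)
      from has_derivative_compose[OF this D(1)] show ?thesis
        using linear_cmul[OF has_derivative_linear[OF D(1)]] by simp
    qed
    show "C_k k (\<lambda>x. r * D (r *\<^sub>R x) b)" if "b \<in> Basis" for b
      by (intro C_k_mult C_k_const Suc.IH D(2) that)
  qed
qed

lemma test_function_scale:
  assumes "test_function \<phi>" "r > 0"
  shows "test_function (\<lambda>x. \<phi> (r *\<^sub>R x))"
proof -
  have "bounded {x. \<phi> x \<noteq> 0}"
    using assms compact_imp_bounded bounded_subset closure_subset unfolding test_function_def by blast
  then have "bounded ((\<lambda>x. (1 / r) *\<^sub>R x) ` {x. \<phi> x \<noteq> 0})" by (rule bounded_scaling)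
  moreover have "{x. \<phi> (r *\<^sub>R x) \<noteq> 0} \<subseteq> (\<lambda>x. (1 / r) *\<^sub>R x) ` {x. \<phi> x \<noteq> 0}"
  proof
    fix x assume "x \<in> {x. \<phi> (r *\<^sub>R x) \<noteq> 0}"
    then show "x \<in> (\<lambda>x. (1 / r) *\<^sub>R x) ` {x. \<phi> x \<noteq> 0}"
      using assms(2) by (intro image_eqI[of _ _ "r *\<^sub>R x"]) auto
  qed
  ultimately have "bounded {x. \<phi> (r *\<^sub>R x) \<noteq> 0}" using bounded_subset by blast
  then show ?thesis
    using assms(1) C_k_scale by (auto simp: test_function_def compact_closure)
qed

lemma C_k_iter_partial_deriv:
  "(\<And>k. C_k k \<phi>) \<Longrightarrow> set bs \<subseteq> Basis \<Longrightarrow> C_k k (iter_partial_deriv bs \<phi>)"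
proof (induction bs arbitrary: k)
  case (Cons b bs)
  have "C_k (Suc k) (iter_partial_deriv bs \<phi>)"
    by (rule Cons.IH) (use Cons.prems in auto)
  then show ?case using Cons.prems by simp
qed simp

lemma iter_partial_deriv_scale:
  assumes "\<And>k. C_k k \<phi>" "set bs \<subseteq> Basis"
  shows "iter_partial_deriv bs (\<lambda>x. \<phi> (r *\<^sub>R x)) = (\<lambda>x. r ^ length bs * iter_partial_deriv bs \<phi> (r *\<^sub>R x))"
  using assms(2)
proof (induction bs)
  case (Cons b bs)
  let ?g = "iter_partial_deriv bs \<phi>"
  have "C_k (Suc 0) ?g" by (rule C_k_iter_partial_deriv) (use assms(1) Cons.prems in auto)
  then have D: "(?g has_derivative frechet_derivative ?g (at x)) (at x)" for x
    by (auto simp: frechet_derivative_works)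
  have "((\<lambda>x. r ^ length bs * ?g (r *\<^sub>R x)) has_derivative
     (\<lambda>y. r ^ length bs * (r * frechet_derivative ?g (at (r *\<^sub>R x)) y))) (at x)" for x
  proof -
    have "((\<lambda>x. r *\<^sub>R x) has_derivative (\<lambda>y. r *\<^sub>R y)) (at x)" by (auto intro!: derivative_eq_intros)
    from has_derivative_mult_right[OF has_derivative_compose[OF this D]] show ?thesis
      using linear_cmul[OF has_derivative_linear[OF D]] by simp
  qed
  from partial_deriv_eq[OF this] show ?case
    using Cons by (simp add: partial_deriv_def mult_ac)
qed simp

lemma integral_lborel_scale:
  fixes f :: "'a::euclidean_space \<Rightarrow> real"
  assumes [measurable]: "f \<in> borel_measurable borel" and c: "c > 0"
  shows "(\<integral>x. f x \<partial>lborel) = c ^ DIM('a) * (\<integral>x. f (c *\<^sub>R x) \<partial>lborel)"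
  by (subst lborel_affine[of c 0])
     (use c in \<open>simp_all add: integral_density integral_distr ennreal_power\<close>)

lemma integrable_lborel_scale:
  fixes f :: "'a::euclidean_space \<Rightarrow> real"
  assumes f: "integrable lborel f" and c: "c > 0"
  shows "integrable lborel (\<lambda>x. f (c *\<^sub>R x))"
proof (rule integrableI_bounded)
  have [measurable]: "f \<in> borel_measurable borel" using f by (simp add: borel_measurable_integrable)
  show "(\<lambda>x. f (c *\<^sub>R x)) \<in> borel_measurable lborel" by measurable
  have "ennreal (c ^ DIM('a)) * (\<integral>\<^sup>+x. ennreal (norm (f (c *\<^sub>R x))) \<partial>lborel) < \<infinity>"
    using f nn_integral_lborel_affine[of "\<lambda>x. ennreal (norm (f x))" c 0] c by (simp add: integrable_iff_bounded)
  then show "(\<integral>\<^sup>+x. ennreal (norm (f (c *\<^sub>R x))) \<partial>lborel) < \<infinity>"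
    using c by (auto simp: ennreal_mult_less_top)
qed

lemma L2_scale:
  assumes "u \<in> L2" "c > 0"
  shows "(\<lambda>x. u (c *\<^sub>R x)) \<in> L2"
proof -
  have [measurable]: "u \<in> borel_measurable borel" using assms(1) by (rule L2_measurable)
  have "(\<lambda>x. u (c *\<^sub>R x)) \<in> borel_measurable borel" by measurable
  then show ?thesis
    using integrable_lborel_scale[of "\<lambda>x. (u x)\<^sup>2", OF _ assms(2)] assms(1) by (auto simp: L2_def)
qed

text \<open>
  Substituting in the integral moves the dilation from \<open>u\<close> to the test function, and each derivative
  that passes through the inverse dilation produces one factor \<open>\<mu>\<close>.
\<close>
lemma has_weak_partial_deriv_scale:
  fixes u w :: "'a::euclidean_space \<Rightarrow> real"
  assumes uw: "has_weak_partial_deriv u bs w" and u: "u \<in> L2" and w: "w \<in> L2"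
    and bs: "set bs \<subseteq> Basis" and \<mu>: "\<mu> > 0"
  shows "has_weak_partial_deriv (\<lambda>x. l * u (\<mu> *\<^sub>R x)) bs (\<lambda>x. l * \<mu> ^ length bs * w (\<mu> *\<^sub>R x))"
  unfolding has_weak_partial_deriv_def
proof (intro allI impI)
  fix \<phi> :: "'a \<Rightarrow> real" assume \<phi>: "test_function \<phi>"
  let ?n = "length bs" and ?\<psi> = "\<lambda>y. \<phi> ((1 / \<mu>) *\<^sub>R y)"
  have Ck: "C_k k \<phi>" for k using \<phi> by (simp add: test_function_def)
  have \<psi>: "test_function ?\<psi>" using \<mu> by (intro test_function_scale \<phi>) simp
  have [measurable]: "u \<in> borel_measurable borel" "w \<in> borel_measurable borel"
    using u w by (auto simp: L2_measurable)
  have [measurable]: "\<phi> \<in> borel_measurable borel" "iter_partial_deriv bs \<phi> \<in> borel_measurable borel"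
    by (intro borel_measurable_continuous_onI C_k_imp_continuous[OF C_k_iter_partial_deriv[OF Ck bs, of 0]] C_k_imp_continuous[OF Ck[of 0]])+
  have iter: "iter_partial_deriv bs \<phi> ((1 / \<mu>) *\<^sub>R y) = \<mu> ^ ?n * iter_partial_deriv bs ?\<psi> y" for y
    using \<mu> by (simp add: iter_partial_deriv_scale[OF Ck bs] power_one_over)
  have "\<mu> ^ DIM('a) * (\<integral>x. l * u (\<mu> *\<^sub>R x) * iter_partial_deriv bs \<phi> x \<partial>lborel)
     = (\<integral>y. l * u y * iter_partial_deriv bs \<phi> ((1 / \<mu>) *\<^sub>R y) \<partial>lborel)"
    using \<mu> by (subst integral_lborel_scale[of _ \<mu>]) auto
  also have "\<dots> = (\<integral>y. l * \<mu> ^ ?n * (u y * iter_partial_deriv bs ?\<psi> y) \<partial>lborel)"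
    unfolding iter by (simp add: mult_ac)
  also have "\<dots> = l * \<mu> ^ ?n * (\<integral>y. u y * iter_partial_deriv bs ?\<psi> y \<partial>lborel)"
    by (rule integral_mult_right_zero)
  also have "\<dots> = l * \<mu> ^ ?n * ((- 1) ^ ?n * (\<integral>y. w y * ?\<psi> y \<partial>lborel))"
    using uw \<psi> unfolding has_weak_partial_deriv_def by simp
  also have "\<dots> = (- 1) ^ ?n * (\<integral>y. l * \<mu> ^ ?n * (w y * ?\<psi> y) \<partial>lborel)"
    unfolding integral_mult_right_zero by (simp only: mult_ac)
  also have "(\<integral>y. l * \<mu> ^ ?n * (w y * ?\<psi> y) \<partial>lborel) = \<mu> ^ DIM('a) * (\<integral>x. l * \<mu> ^ ?n * w (\<mu> *\<^sub>R x) * \<phi> x \<partial>lborel)"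
    using \<mu> by (subst integral_lborel_scale[of _ \<mu>]) (auto simp: mult.assoc)
  finally have "\<mu> ^ DIM('a) * (\<integral>x. l * u (\<mu> *\<^sub>R x) * iter_partial_deriv bs \<phi> x \<partial>lborel)
    = \<mu> ^ DIM('a) * ((- 1) ^ ?n * (\<integral>x. l * \<mu> ^ ?n * w (\<mu> *\<^sub>R x) * \<phi> x \<partial>lborel))" by (simp add: mult_ac)
  then show "(\<integral>x. l * u (\<mu> *\<^sub>R x) * iter_partial_deriv bs \<phi> x \<partial>lborel)
    = (- 1) ^ ?n * (\<integral>x. l * \<mu> ^ ?n * w (\<mu> *\<^sub>R x) * \<phi> x \<partial>lborel)" using \<mu> by simp
qed

lemma sobolev_H_scale:
  assumes u: "u \<in> sobolev_H k" and \<mu>: "\<mu> > 0"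
  shows "(\<lambda>x. l * u (\<mu> *\<^sub>R x)) \<in> sobolev_H k"
proof -
  have uL: "u \<in> L2" using u by (simp add: sobolev_H_def)
  have "\<exists>v\<in>L2. has_weak_partial_deriv (\<lambda>x. l * u (\<mu> *\<^sub>R x)) bs v" if bs: "set bs \<subseteq> Basis" "length bs \<le> k" for bs
  proof -
    note w = weak_partial_deriv_props[OF u bs]
    show ?thesis
      using has_weak_partial_deriv_scale[OF w(2) uL w(1) bs(1) \<mu>, of l]
        L2_cmult[OF L2_scale[OF w(1) \<mu>], of "l * \<mu> ^ length bs"] by blast
  qed
  then show ?thesis using L2_cmult[OF L2_scale[OF uL \<mu>]] by (auto simp: sobolev_H_def)
qed

lemma weak_partial_deriv_unique:
  fixes u :: "real^4 \<Rightarrow> real"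
  assumes "has_weak_partial_deriv u bs v" "has_weak_partial_deriv u bs w" "v \<in> L2" "w \<in> L2"
  shows "AE x in lborel. v x = w x"
proof -
  have d: "(\<lambda>x. v x - w x) \<in> L2" using L2_add[OF assms(3) L2_cmult[OF assms(4), of "-1"]] by simp
  have "AE x in lborel. v x - w x = 0"
  proof (rule fundamental_lemma[OF d])
    fix \<phi> :: "real^4 \<Rightarrow> real" assume \<phi>: "test_function \<phi>"
    have "\<phi> \<in> L2"
    proof (rule L2_continuous_compact_support)
      show "continuous_on UNIV \<phi>" using \<phi> C_k_imp_continuous unfolding test_function_def by blast
      show "compact (closure {x. \<phi> x \<noteq> 0})" using \<phi> by (simp add: test_function_def)
      show "\<phi> x = 0" if "x \<notin> closure {x. \<phi> x \<noteq> 0}" for x using that closure_subset[of "{x. \<phi> x \<noteq> 0}"] by auto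
    qed
    then have i: "integrable lborel (\<lambda>x. v x * \<phi> x)" "integrable lborel (\<lambda>x. w x * \<phi> x)"
      by (intro L2_mult_integrable assms; assumption)+
    have "(- 1) ^ length bs * (\<integral>x. v x * \<phi> x \<partial>lborel) = (- 1) ^ length bs * (\<integral>x. w x * \<phi> x \<partial>lborel)"
      using assms(1,2)[unfolded has_weak_partial_deriv_def, rule_format, OF \<phi>] by (rule trans[OF sym])
    then show "(\<integral>x. (v x - w x) * \<phi> x \<partial>lborel) = 0" using i by (simp add: left_diff_distrib)
  qed
  then show ?thesis by eventually_elim simp
qed

text \<open>
  Only an almost everywhere statement: both sides involve independent choices of representatives,
  which are compared by uniqueness of weak derivatives.
\<close>
lemma weak_laplacian_scale:
  fixes u :: "real^4 \<Rightarrow> real"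
  assumes u: "u \<in> sobolev_H 2" and \<mu>: "\<mu> > 0"
  shows "AE x in lborel. weak_laplacian (\<lambda>x. l * u (\<mu> *\<^sub>R x)) x = l * \<mu>\<^sup>2 * weak_laplacian u (\<mu> *\<^sub>R x)"
proof -
  let ?v = "\<lambda>x. l * u (\<mu> *\<^sub>R x)"
  have uL: "u \<in> L2" using u by (simp add: sobolev_H_def)
  have v: "?v \<in> sobolev_H 2" by (rule sobolev_H_scale[OF u \<mu>])
  have "AE x in lborel. weak_partial_deriv [b, b] ?v x = l * \<mu>\<^sup>2 * weak_partial_deriv [b, b] u (\<mu> *\<^sub>R x)" if b: "b \<in> Basis" for b
  proof -
    have bb: "set [b, b] \<subseteq> Basis" "length [b, b] \<le> 2" using b by auto
    note wu = weak_partial_deriv_props[OF u bb] and wv = weak_partial_deriv_props[OF v bb]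
    have "has_weak_partial_deriv ?v [b, b] (\<lambda>x. l * \<mu>\<^sup>2 * weak_partial_deriv [b, b] u (\<mu> *\<^sub>R x))"
      using has_weak_partial_deriv_scale[OF wu(2) uL wu(1) bb(1) \<mu>, of l] by (simp add: power2_eq_square)
    then show ?thesis
      by (rule weak_partial_deriv_unique[OF wv(2) _ wv(1) L2_cmult[OF L2_scale[OF wu(1) \<mu>]]])
  qed
  then have "AE x in lborel. \<forall>b\<in>Basis. weak_partial_deriv [b, b] ?v x = l * \<mu>\<^sup>2 * weak_partial_deriv [b, b] u (\<mu> *\<^sub>R x)"
    by (intro AE_finite_allI) auto
  then show ?thesis
    by eventually_elim (simp add: weak_laplacian_def sum_distrib_left)
qed

section \<open>Rescaling within the unit sphere and the comparison of levels\<close>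

definition L2_sq :: "(real^4 \<Rightarrow> real) \<Rightarrow> real" where
  "L2_sq u = (\<integral>x. (u x)\<^sup>2 \<partial>lborel)"

definition exp_energy :: "(real^4 \<Rightarrow> real) \<Rightarrow> ennreal" where
  "exp_energy u = (\<integral>\<^sup>+x. ennreal (exp_rem (32 * pi\<^sup>2 * (u x)\<^sup>2)) \<partial>lborel)"

lemma L2_sq_nonneg: "L2_sq u \<ge> 0"
  by (simp add: L2_sq_def)

lemma H_iff: "u \<in> H \<longleftrightarrow> u \<in> sobolev_H 2 \<and> L2_sq u + L2_sq (weak_laplacian u) = 1"
proof (cases "u \<in> sobolev_H 2")
  case True
  then have "u \<in> L2" "weak_laplacian u \<in> L2" by (auto simp: sobolev_H_def weak_laplacian_L2)
  then have "(\<integral>x. \<bar>u x\<bar>\<^sup>2 + \<bar>weak_laplacian u x\<bar>\<^sup>2 \<partial>lborel) = L2_sq u + L2_sq (weak_laplacian u)"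
    unfolding L2_sq_def L2_def by (simp add: Bochner_Integration.integral_add)
  then show ?thesis using True by (simp add: H_def H2_norm_def)
qed (simp add: H_def)

lemma L2_sq_cong_AE: "AE x in lborel. u x = v x \<Longrightarrow> u \<in> L2 \<Longrightarrow> v \<in> L2 \<Longrightarrow> L2_sq u = L2_sq v"
  unfolding L2_sq_def by (intro integral_cong_AE) (auto simp: L2_def)

lemma L2_sq_scale:
  assumes u: "u \<in> L2" and \<mu>: "\<mu> > 0"
  shows "L2_sq (\<lambda>x. l * u (\<mu> *\<^sub>R x)) = l\<^sup>2 / \<mu> ^ 4 * L2_sq u"
proof -
  have [measurable]: "u \<in> borel_measurable borel" using u by (rule L2_measurable)
  have "L2_sq u = \<mu> ^ 4 * (\<integral>x. (u (\<mu> *\<^sub>R x))\<^sup>2 \<partial>lborel)"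
    unfolding L2_sq_def by (subst integral_lborel_scale[of _ \<mu>]) (use \<mu> in auto)
  then show ?thesis using \<mu> by (simp add: L2_sq_def power_mult_distrib)
qed

lemma exp_energy_scale:
  assumes u: "u \<in> L2" and \<mu>: "\<mu> > 0"
  shows "(\<integral>\<^sup>+x. ennreal (exp_rem (32 * pi\<^sup>2 * (l\<^sup>2 * (u x)\<^sup>2))) \<partial>lborel)
    = ennreal (\<mu> ^ 4) * exp_energy (\<lambda>x. l * u (\<mu> *\<^sub>R x))"
proof -
  have [measurable]: "u \<in> borel_measurable borel" using u by (rule L2_measurable)
  have "(\<integral>\<^sup>+x. ennreal (exp_rem (32 * pi\<^sup>2 * (l\<^sup>2 * (u x)\<^sup>2))) \<partial>lborel)
    = ennreal (\<bar>\<mu>\<bar> ^ DIM(real^4)) * (\<integral>\<^sup>+x. ennreal (exp_rem (32 * pi\<^sup>2 * (l\<^sup>2 * (u (0 + \<mu> *\<^sub>R x))\<^sup>2))) \<partial>lborel)"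
    using \<mu> unfolding exp_rem_def by (intro nn_integral_lborel_affine) auto
  then show ?thesis using \<mu> by (simp add: exp_energy_def power_mult_distrib)
qed

text \<open>
  Splits off the quadratic part, which is the only part that depends on \<open>\<alpha>\<close>.
\<close>
lemma adams_functional_eq:
  assumes u: "u \<in> L2" and \<alpha>: "\<alpha> \<le> 32 * pi\<^sup>2"
  shows "adams_functional \<alpha> u = exp_energy u + ennreal ((32 * pi\<^sup>2 - \<alpha>) * L2_sq u)"
proof -
  have [measurable]: "u \<in> borel_measurable borel" using u by (rule L2_measurable)
  have [measurable]: "(\<lambda>x. exp_rem (32 * pi\<^sup>2 * (u x)\<^sup>2)) \<in> borel_measurable borel"
    unfolding exp_rem_def by measurable
  have "adams_functional \<alpha> u = (\<integral>\<^sup>+x. ennreal (exp_rem (32 * pi\<^sup>2 * (u x)\<^sup>2)) + ennreal ((32 * pi\<^sup>2 - \<alpha>) * (u x)\<^sup>2) \<partial>lborel)"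
    unfolding adams_functional_def
  proof (rule nn_integral_cong)
    fix x
    have "adams_integrand \<alpha> (u x) = exp_rem (32 * pi\<^sup>2 * (u x)\<^sup>2) + (32 * pi\<^sup>2 - \<alpha>) * (u x)\<^sup>2"
      by (simp add: adams_integrand_def exp_rem_def algebra_simps)
    then show "ennreal (adams_integrand \<alpha> (u x)) = ennreal (exp_rem (32 * pi\<^sup>2 * (u x)\<^sup>2)) + ennreal ((32 * pi\<^sup>2 - \<alpha>) * (u x)\<^sup>2)"
      using \<alpha> exp_rem_nonneg by (simp add: ennreal_plus)
  qed
  also have "\<dots> = exp_energy u + (\<integral>\<^sup>+x. ennreal ((32 * pi\<^sup>2 - \<alpha>) * (u x)\<^sup>2) \<partial>lborel)"
    unfolding exp_energy_def by (rule nn_integral_add) auto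
  also have "(\<integral>\<^sup>+x. ennreal ((32 * pi\<^sup>2 - \<alpha>) * (u x)\<^sup>2) \<partial>lborel) = ennreal (\<integral>x. (32 * pi\<^sup>2 - \<alpha>) * (u x)\<^sup>2 \<partial>lborel)"
    using \<alpha> u by (intro nn_integral_eq_integral) (auto simp: L2_def)
  finally show ?thesis by (simp add: L2_sq_def)
qed

text \<open>
  The series of \<open>exp_rem\<close> starts with the quadratic term, and \<open>s\<^sup>k \<le> s\<^sup>2\<close> for \<open>k \<ge> 2\<close>.
\<close>
lemma exp_rem_scale:
  assumes "0 \<le> s" "s \<le> 1" "0 \<le> t"
  shows "exp_rem (s * t) \<le> s\<^sup>2 * exp_rem t"
proof -
  have ser: "(\<lambda>n. x ^ (n + 2) / fact (n + 2)) sums exp_rem x" for x :: real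
  proof -
    have "(\<lambda>n. x ^ n / fact n) sums exp x"
      using exp_converges[of x] by (simp add: divide_inverse mult.commute)
    from sums_split_initial_segment[OF this, of 2] show ?thesis
      by (simp add: exp_rem_def numeral_2_eq_2 diff_diff_eq)
  qed
  show ?thesis
  proof (rule sums_le[OF _ ser sums_mult[OF ser]])
    fix n
    have "s ^ (n + 2) \<le> s\<^sup>2" using assms by (intro power_decreasing) auto
    then have "s ^ (n + 2) * (t ^ (n + 2) / fact (n + 2)) \<le> s\<^sup>2 * (t ^ (n + 2) / fact (n + 2))"
      using assms by (intro mult_right_mono) auto
    then show "(s * t) ^ (n + 2) / fact (n + 2) \<le> s\<^sup>2 * (t ^ (n + 2) / fact (n + 2))"
      by (simp only: power_mult_distrib times_divide_eq_right mult.assoc)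
  qed
qed

lemma L2_sq_eq_0: "u \<in> L2 \<Longrightarrow> L2_sq u = 0 \<Longrightarrow> AE x in lborel. u x = 0"
  unfolding L2_sq_def L2_def by (auto simp: integral_nonneg_eq_0_iff_AE)

text \<open>
  A function that vanishes almost everywhere has vanishing weak derivatives, so it cannot lie on the
  unit sphere.
\<close>
lemma H_L2_sq_pos:
  assumes "u \<in> H" shows "L2_sq u > 0"
proof (rule ccontr)
  assume "\<not> L2_sq u > 0"
  then have n0: "L2_sq u = 0" using L2_sq_nonneg[of u] by linarith
  have u: "u \<in> sobolev_H 2" and sum: "L2_sq u + L2_sq (weak_laplacian u) = 1" using assms by (auto simp: H_iff)
  have uL: "u \<in> L2" using u by (simp add: sobolev_H_def)
  have u0: "AE x in lborel. u x = 0" by (rule L2_sq_eq_0[OF uL n0])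
  have "AE x in lborel. weak_partial_deriv [b, b] u x = 0" if b: "b \<in> Basis" for b
  proof (rule fundamental_lemma)
    have bb: "set [b, b] \<subseteq> Basis" "length [b, b] \<le> 2" using b by auto
    show "weak_partial_deriv [b, b] u \<in> L2" by (rule weak_partial_deriv_props(1)[OF u bb])
    fix \<phi> :: "real^4 \<Rightarrow> real" assume \<phi>: "test_function \<phi>"
    have "(\<integral>x. u x * iter_partial_deriv [b, b] \<phi> x \<partial>lborel) = (\<integral>x. 0 \<partial>(lborel :: (real^4) measure))"
    proof (rule integral_cong_AE)
      have "C_k 0 (iter_partial_deriv [b, b] \<phi>)"
        by (rule C_k_iter_partial_deriv) (use \<phi> b in \<open>auto simp: test_function_def\<close>)
      then have "iter_partial_deriv [b, b] \<phi> \<in> borel_measurable borel"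
        by (intro borel_measurable_continuous_onI) (simp only: C_k.simps)
      from borel_measurable_times[OF L2_measurable[OF uL] this]
      show "(\<lambda>x. u x * iter_partial_deriv [b, b] \<phi> x) \<in> borel_measurable lborel"
        by (simp del: iter_partial_deriv.simps)
      show "AE x in lborel. u x * iter_partial_deriv [b, b] \<phi> x = 0" using u0 by eventually_elim simp
    qed simp
    then show "(\<integral>x. weak_partial_deriv [b, b] u x * \<phi> x \<partial>lborel) = 0"
      using weak_partial_deriv_props(2)[OF u bb] \<phi> unfolding has_weak_partial_deriv_def by simp
  qed
  then have "AE x in lborel. \<forall>b\<in>Basis. weak_partial_deriv [b, b] u x = 0" by (intro AE_finite_allI) auto
  then have "AE x in lborel. weak_laplacian u x = 0" by eventually_elim (simp add: weak_laplacian_def)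
  then have "L2_sq (weak_laplacian u) = L2_sq (\<lambda>x. 0)"
    by (rule L2_sq_cong_AE) (intro weak_laplacian_L2 u L2_zero)+
  then show False using n0 sum by (simp add: L2_sq_def)
qed

text \<open>
  The amplitude \<open>l\<close> determines the share of the Laplacian in the norm; the dilation \<open>\<mu>\<close> is then used up
  to normalise.
\<close>
lemma H_scale:
  assumes u: "u \<in> H" and l: "l > 0" and ld: "l\<^sup>2 * L2_sq (weak_laplacian u) < 1"
  obtains v where "v \<in> H" "L2_sq v = 1 - l\<^sup>2 * L2_sq (weak_laplacian u)"
    "(\<integral>\<^sup>+x. ennreal (exp_rem (32 * pi\<^sup>2 * (l\<^sup>2 * (u x)\<^sup>2))) \<partial>lborel)
      = ennreal (l\<^sup>2 * L2_sq u / (1 - l\<^sup>2 * L2_sq (weak_laplacian u))) * exp_energy v"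
proof -
  let ?n = "L2_sq u" and ?d = "L2_sq (weak_laplacian u)"
  have us: "u \<in> sobolev_H 2" using u by (simp add: H_iff)
  have uL: "u \<in> L2" using us by (simp add: sobolev_H_def)
  have n: "?n > 0" by (rule H_L2_sq_pos[OF u])
  \<comment> \<open>Solves \<open>l\<^sup>2 n / \<mu>^4 = 1 - l\<^sup>2 d\<close>, the normalisation of the rescaled function.\<close>
  define \<mu> where "\<mu> = root 4 (l\<^sup>2 * ?n / (1 - l\<^sup>2 * ?d))"
  have arg: "l\<^sup>2 * ?n / (1 - l\<^sup>2 * ?d) > 0" using n l ld by simp
  have \<mu>: "\<mu> > 0" "\<mu> ^ 4 = l\<^sup>2 * ?n / (1 - l\<^sup>2 * ?d)"
    using arg by (simp_all add: \<mu>_def)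
  define v where "v = (\<lambda>x. l * u (\<mu> *\<^sub>R x))"
  have vs: "v \<in> sobolev_H 2" unfolding v_def by (rule sobolev_H_scale[OF us \<mu>(1)])
  have nv: "L2_sq v = 1 - l\<^sup>2 * ?d"
  proof -
    have "L2_sq v = l\<^sup>2 / \<mu> ^ 4 * ?n" unfolding v_def by (rule L2_sq_scale[OF uL \<mu>(1)])
    also have "\<dots> = 1 - l\<^sup>2 * ?d" unfolding \<mu>(2) using n l ld by (simp add: field_simps)
    finally show ?thesis .
  qed
  have "L2_sq (weak_laplacian v) = L2_sq (\<lambda>x. (l * \<mu>\<^sup>2) * weak_laplacian u (\<mu> *\<^sub>R x))"
    using weak_laplacian_scale[OF us \<mu>(1), of l] unfolding v_def[symmetric]
    by (rule L2_sq_cong_AE) (use weak_laplacian_L2[OF vs] L2_cmult[OF L2_scale[OF weak_laplacian_L2[OF us] \<mu>(1)]] in auto)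
  also have "\<dots> = (l * \<mu>\<^sup>2)\<^sup>2 / \<mu> ^ 4 * ?d" by (rule L2_sq_scale[OF weak_laplacian_L2[OF us] \<mu>(1)])
  also have "\<dots> = l\<^sup>2 * ?d" using \<mu>(1) by (simp add: power_mult_distrib flip: power_mult)
  finally have dv: "L2_sq (weak_laplacian v) = l\<^sup>2 * ?d" .
  show ?thesis
  proof (rule that)
    show "v \<in> H" using vs nv dv by (simp add: H_iff)
    show "L2_sq v = 1 - l\<^sup>2 * ?d" by (rule nv)
    show "(\<integral>\<^sup>+x. ennreal (exp_rem (32 * pi\<^sup>2 * (l\<^sup>2 * (u x)\<^sup>2))) \<partial>lborel) = ennreal (l\<^sup>2 * ?n / (1 - l\<^sup>2 * ?d)) * exp_energy v"
      using exp_energy_scale[OF uL \<mu>(1), of l] unfolding v_def[symmetric] \<mu>(2) .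
  qed
qed

lemma exp_energy_finite: "u \<in> H \<Longrightarrow> exp_energy u < \<infinity>"
  unfolding exp_energy_def by (rule exp_rem_integrable) (auto simp: H_iff)

text \<open>
  Enlarging the amplitude by \<open>l\<close> gains the factor \<open>1 / l^4\<close> from \<open>exp_rem_scale\<close> with
  \<open>s = 1 / l\<^sup>2\<close>, whereas the dilation that renormalises costs only a factor of order \<open>l\<^sup>2\<close>.
\<close>
lemma exp_energy_le_scaled:
  assumes u: "u \<in> H" and M: "\<And>v. v \<in> H \<Longrightarrow> exp_energy v \<le> ennreal M" and M0: "M \<ge> 0"
    and l: "l \<ge> 1" and ld: "l\<^sup>2 * L2_sq (weak_laplacian u) < 1"
  shows "exp_energy u \<le> ennreal (L2_sq u * M / (l\<^sup>2 * (1 - l\<^sup>2 * L2_sq (weak_laplacian u))))"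
proof -
  let ?n = "L2_sq u" and ?d = "L2_sq (weak_laplacian u)"
  have [measurable]: "u \<in> borel_measurable borel" using u by (auto simp: H_iff sobolev_H_def L2_measurable)
  have l0: "l > 0" using l by simp
  obtain v where v: "v \<in> H" "(\<integral>\<^sup>+x. ennreal (exp_rem (32 * pi\<^sup>2 * (l\<^sup>2 * (u x)\<^sup>2))) \<partial>lborel)
      = ennreal (l\<^sup>2 * ?n / (1 - l\<^sup>2 * ?d)) * exp_energy v"
    using H_scale[OF u l0 ld] by metis
  have "exp_energy u \<le> (\<integral>\<^sup>+x. ennreal (1 / l ^ 4) * ennreal (exp_rem (32 * pi\<^sup>2 * (l\<^sup>2 * (u x)\<^sup>2))) \<partial>lborel)"
    unfolding exp_energy_def
  proof (rule nn_integral_mono)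
    fix x
    have "exp_rem (1 / l\<^sup>2 * (32 * pi\<^sup>2 * (l\<^sup>2 * (u x)\<^sup>2))) \<le> (1 / l\<^sup>2)\<^sup>2 * exp_rem (32 * pi\<^sup>2 * (l\<^sup>2 * (u x)\<^sup>2))"
      using l by (intro exp_rem_scale) auto
    also have "1 / l\<^sup>2 * (32 * pi\<^sup>2 * (l\<^sup>2 * (u x)\<^sup>2)) = 32 * pi\<^sup>2 * (u x)\<^sup>2" using l0 by simp
    also have "(1 / l\<^sup>2)\<^sup>2 = 1 / l ^ 4" by (simp add: power_divide flip: power_mult)
    finally show "ennreal (exp_rem (32 * pi\<^sup>2 * (u x)\<^sup>2)) \<le> ennreal (1 / l ^ 4) * ennreal (exp_rem (32 * pi\<^sup>2 * (l\<^sup>2 * (u x)\<^sup>2)))"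
      using l0 exp_rem_nonneg by (simp add: ennreal_mult[symmetric] ennreal_leI)
  qed
  also have "\<dots> = ennreal (1 / l ^ 4) * (ennreal (l\<^sup>2 * ?n / (1 - l\<^sup>2 * ?d)) * exp_energy v)"
    unfolding v(2)[symmetric] exp_rem_def by (rule nn_integral_cmult) measurable
  also have "\<dots> \<le> ennreal (1 / l ^ 4) * (ennreal (l\<^sup>2 * ?n / (1 - l\<^sup>2 * ?d)) * ennreal M)"
    by (intro mult_left_mono M v) auto
  also have "\<dots> = ennreal (1 / l ^ 4 * (l\<^sup>2 * ?n / (1 - l\<^sup>2 * ?d) * M))"
    using l0 ld M0 L2_sq_nonneg[of u] by (simp add: ennreal_mult[symmetric] less_imp_le)
  also have "1 / l ^ 4 * (l\<^sup>2 * ?n / (1 - l\<^sup>2 * ?d) * M) = ?n * M / (l\<^sup>2 * (1 - l\<^sup>2 * ?d))"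
  proof -
    have l4: "l ^ 4 = l\<^sup>2 * l\<^sup>2" by (simp flip: power_add)
    define s where "s = l\<^sup>2"
    have "s > 0" using l0 by (simp add: s_def)
    then show ?thesis unfolding l4 s_def[symmetric] by simp
  qed
  finally show ?thesis .
qed

text \<open>
  A form of Liouville's theorem obtained by scaling: without a Laplacian term the amplitude \<open>l\<close> may be
  arbitrarily large, so a uniform bound on the exponential energies forces that of \<open>u\<close> to vanish.
\<close>
lemma H_laplacian_pos:
  assumes u: "u \<in> H" and M: "\<And>v. v \<in> H \<Longrightarrow> exp_energy v \<le> ennreal M" and M0: "M \<ge> 0"
  shows "L2_sq (weak_laplacian u) > 0"
proof (rule ccontr)
  assume "\<not> ?thesis"
  then have d0: "L2_sq (weak_laplacian u) = 0" using L2_sq_nonneg[of "weak_laplacian u"] by linarith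
  have n1: "L2_sq u = 1" using u d0 by (simp add: H_iff)
  have uL: "u \<in> L2" using u by (simp add: H_iff sobolev_H_def)
  have [measurable]: "u \<in> borel_measurable borel" using uL by (rule L2_measurable)
  have eps: "exp_energy u \<le> 0 + ennreal e" if e: "e > 0" for e
  proof -
    define l where "l = max 1 (M / e)"
    have l: "l \<ge> 1" "M / e \<le> l" by (auto simp: l_def)
    have "M \<le> e * l" using l(2) e by (simp add: field_simps)
    also have "\<dots> \<le> e * l\<^sup>2" using l e by (intro mult_left_mono) (auto simp: self_le_power)
    finally have "M / l\<^sup>2 \<le> e" using l by (simp add: field_simps)
    moreover have "exp_energy u \<le> ennreal (M / l\<^sup>2)"
      using exp_energy_le_scaled[OF u M M0 l(1)] by (simp add: d0 n1)
    ultimately show ?thesis by (auto intro: order_trans ennreal_leI)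
  qed
  have "exp_energy u \<le> 0" by (rule ennreal_le_epsilon, rule eps)
  then have "AE x in lborel. ennreal (exp_rem (32 * pi\<^sup>2 * (u x)\<^sup>2)) = 0"
    unfolding exp_energy_def by (subst nn_integral_0_iff_AE[symmetric]) (auto simp: exp_rem_def)
  then have "AE x in lborel. u x = 0"
  proof eventually_elim
    case (elim x)
    show ?case
    proof (rule ccontr)
      assume "u x \<noteq> 0"
      then have t: "0 < 32 * pi\<^sup>2 * (u x)\<^sup>2" by simp
      have "1 + t < exp t" if "t > 0" for t :: real
        using exp_ge_one_plus_x_over_n_power_n[of 2 t] that by (simp add: power2_eq_square field_simps) (smt (verit) mult_pos_pos)
      then have "exp_rem (32 * pi\<^sup>2 * (u x)\<^sup>2) > 0"
        unfolding exp_rem_def using t by (metis diff_gt_0_iff_gt diff_diff_eq)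
      then show False using elim by (simp add: ennreal_eq_0_iff)
    qed
  qed
  then have "L2_sq u = L2_sq (\<lambda>x. 0)" by (rule L2_sq_cong_AE[OF _ uL L2_zero])
  then show False using n1 by (simp add: L2_sq_def)
qed

text \<open>
  For \<open>d \<le> 1/2\<close> the amplitude is chosen such that the Laplacian of the rescaled function carries exactly
  half of the norm; for \<open>d > 1/2\<close> the bound by \<open>M\<close> is already strong enough.
\<close>
lemma exp_energy_le_laplacian:
  assumes u: "u \<in> H" and M: "\<And>v. v \<in> H \<Longrightarrow> exp_energy v \<le> ennreal M" and M0: "M \<ge> 0"
  shows "exp_energy u \<le> ennreal (4 * M * L2_sq (weak_laplacian u))"
proof (cases "L2_sq (weak_laplacian u) \<le> 1 / 2")
  case False
  then have "M * 1 \<le> M * (4 * L2_sq (weak_laplacian u))" using M0 by (intro mult_left_mono) auto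
  then show ?thesis using M[OF u] by (auto intro: order_trans ennreal_leI simp: mult_ac)
next
  case True
  let ?n = "L2_sq u" and ?d = "L2_sq (weak_laplacian u)"
  have d: "?d > 0" by (rule H_laplacian_pos[OF u M M0])
  define l where "l = sqrt (1 / (2 * ?d))"
  have l2: "l\<^sup>2 = 1 / (2 * ?d)" using d by (simp add: l_def)
  have l: "l \<ge> 1" using True d by (simp add: l_def)
  have ld: "l\<^sup>2 * ?d = 1 / 2" using d by (simp add: l2)
  have n: "?n \<le> 1" using u d by (simp add: H_iff)
  have "exp_energy u \<le> ennreal (?n * M / (l\<^sup>2 * (1 - l\<^sup>2 * ?d)))"
    by (rule exp_energy_le_scaled[OF u M M0 l]) (simp_all add: ld)
  also have "?n * M / (l\<^sup>2 * (1 - l\<^sup>2 * ?d)) = ?n * (4 * M * ?d)"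
    unfolding ld l2 using d by (simp add: field_simps)
  also have "\<dots> \<le> 1 * (4 * M * ?d)" using n d M0 by (intro mult_right_mono) auto
  finally show ?thesis by (simp add: ennreal_leI)
qed

text \<open>
  Rescaling with a small amplitude moves almost the entire norm into the quadratic part of the
  functional.
\<close>
lemma S_ge_vanishing_level:
  assumes u: "u \<in> H" and \<alpha>: "\<alpha> < 32 * pi\<^sup>2" and r: "r < 32 * pi\<^sup>2 - \<alpha>"
  shows "ennreal r \<le> S \<alpha>"
proof -
  let ?\<beta> = "32 * pi\<^sup>2 - \<alpha>" and ?d = "L2_sq (weak_laplacian u)"
  have d1: "0 \<le> ?d" "?d < 1"
    using u H_L2_sq_pos[OF u] L2_sq_nonneg[of "weak_laplacian u"] by (auto simp: H_iff)
  \<comment> \<open>Makes the loss \<open>\<beta> l\<^sup>2 d\<close> at most \<open>\<beta> - r\<close>.\<close>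
  define l where "l = sqrt (min 1 ((?\<beta> - r) / ?\<beta>))"
  have l2: "l\<^sup>2 = min 1 ((?\<beta> - r) / ?\<beta>)" and l: "l > 0" using \<alpha> r by (simp_all add: l_def)
  have ld: "l\<^sup>2 * ?d < 1" using d1 mult_mono[of "l\<^sup>2" 1 ?d ?d] by (simp add: l2)
  obtain v where v: "v \<in> H" "L2_sq v = 1 - l\<^sup>2 * ?d" using H_scale[OF u l ld] by metis
  have "l\<^sup>2 * ?d \<le> (?\<beta> - r) / ?\<beta> * 1" using d1 \<alpha> r by (intro mult_mono) (auto simp: l2)
  then have "r \<le> ?\<beta> * L2_sq v" using \<alpha> unfolding v(2) by (simp add: field_simps)
  then have "ennreal r \<le> exp_energy v + ennreal (?\<beta> * L2_sq v)" by (simp add: add_increasing ennreal_leI)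
  also have "\<dots> = adams_functional \<alpha> v"
    using v(1) \<alpha> by (intro adams_functional_eq[symmetric]) (auto simp: H_iff sobolev_H_def)
  also have "\<dots> \<le> S \<alpha>" unfolding S_def by (rule SUP_upper[OF v(1)])
  finally show ?thesis .
qed

theorem theorem1p5:
  shows "\<exists>\<alpha>ss::real. \<alpha>ss > 0 \<and>
    (\<forall>\<alpha>::real. \<alpha> < 32 * pi\<^sup>2 \<and> 32 * pi\<^sup>2 - \<alpha> > \<alpha>ss \<longrightarrow>
       \<not> (\<exists>u\<in>H. adams_functional \<alpha> u = S \<alpha>))"
proof (cases "(SUP v\<in>H. exp_energy v) = \<infinity>")
  case True
  have "adams_functional \<alpha> u \<noteq> S \<alpha>" if \<alpha>: "\<alpha> < 32 * pi\<^sup>2" and u: "u \<in> H" for \<alpha> u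
  proof -
    have eq: "adams_functional \<alpha> v = exp_energy v + ennreal ((32 * pi\<^sup>2 - \<alpha>) * L2_sq v)" if "v \<in> H" for v
      using that \<alpha> by (intro adams_functional_eq) (auto simp: H_iff sobolev_H_def)
    have "(SUP v\<in>H. exp_energy v) \<le> S \<alpha>" unfolding S_def
      by (rule SUP_subset_mono[OF subset_refl]) (simp add: eq)
    then have "S \<alpha> = \<infinity>" using True by (simp add: top.extremum_unique)
    moreover have "adams_functional \<alpha> u < \<infinity>" using exp_energy_finite[OF u] by (simp add: eq[OF u])
    ultimately show ?thesis by auto
  qed
  then show ?thesis by (intro exI[of _ 1]) auto
next
  case False
  then obtain M where M0: "M \<ge> 0" and M: "(SUP v\<in>H. exp_energy v) = ennreal M"
    by (cases "SUP v\<in>H. exp_energy v") auto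
  have le: "exp_energy v \<le> ennreal M" if "v \<in> H" for v
    using SUP_upper[OF that, of exp_energy] by (simp add: M)
  have "adams_functional \<alpha> u \<noteq> S \<alpha>" if \<alpha>: "32 * pi\<^sup>2 - \<alpha> > 4 * M + 1" and u: "u \<in> H" for \<alpha> u
  proof -
    let ?\<beta> = "32 * pi\<^sup>2 - \<alpha>" and ?n = "L2_sq u" and ?d = "L2_sq (weak_laplacian u)"
    have d: "?d > 0" by (rule H_laplacian_pos[OF u le M0])
    have nd: "?n + ?d = 1" using u by (simp add: H_iff)
    have \<alpha>': "\<alpha> < 32 * pi\<^sup>2" using \<alpha> M0 by simp
    have "4 * M * ?d < ?\<beta> * ?d" using \<alpha> d by (intro mult_strict_right_mono) auto
    moreover have "?\<beta> * ?n + ?\<beta> * ?d = ?\<beta>"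
      unfolding distrib_left[symmetric] nd by simp
    ultimately have lt: "4 * M * ?d + ?\<beta> * ?n < ?\<beta>" by linarith
    \<comment> \<open>A level strictly between, since the lower bound on the supremum concerns levels below \<open>\<beta>\<close>.\<close>
    obtain r where r: "4 * M * ?d + ?\<beta> * ?n < r" "r < ?\<beta>" using dense[OF lt] by blast
    have "adams_functional \<alpha> u = exp_energy u + ennreal (?\<beta> * ?n)"
      using u \<alpha>' by (intro adams_functional_eq) (auto simp: H_iff sobolev_H_def)
    also have "\<dots> \<le> ennreal (4 * M * ?d) + ennreal (?\<beta> * ?n)"
      by (intro add_right_mono exp_energy_le_laplacian[OF u le M0])
    also have "\<dots> = ennreal (4 * M * ?d + ?\<beta> * ?n)"
      using M0 d \<alpha>' L2_sq_nonneg[of u] by (intro ennreal_plus[symmetric]) auto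
    also have "\<dots> < ennreal r"
    proof (rule ennreal_lessI)
      have "0 \<le> 4 * M * ?d + ?\<beta> * ?n" using M0 d \<alpha>' L2_sq_nonneg[of u] by simp
      then show "0 < r" using r by linarith
    qed (rule r)
    also have "\<dots> \<le> S \<alpha>" by (rule S_ge_vanishing_level[OF u \<alpha>' r(2)])
    finally show ?thesis by simp
  qed
  then show ?thesis using M0 by (intro exI[of _ "4 * M + 1"]) auto
qed

end
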